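(* Let $f$, $K$, $u,q,C,\kappa$, $\phi$, the noises $(\xi_n),(\zeta_n),(\chi_n)$, and $\sigma,\lambda$ be as in the context, let $\gamma\in(0,1)$, and suppose $Cu^\kappa<\frac12$. Then there exist positive constants $\varsigma,\eta,\delta$ having property (P) of the context, with $\delta<u$, and parameters of the Directed Walk Control (DWC) from $(K-u,K+u)$ to $(K-\delta,K+\delta)$ such that, for every solution $z$ of the DWC equation with $z_0\in(K-u,K+u)$, the moment $$\tau=\inf\{n: z_n\in(K-\delta,K+\delta)\}$$ is a.s. finite and independent of the $\xi_i$, $i\in\mathbb N$. Therefore, if from the moment $\tau$ on the solution is continued by $$z_{n+1}=f(z_n)+\sigma\xi_{n+1}(z_n-K),\quad n\ge\tau,$$ then: (i) there exists a set $\Omega_\gamma$ with $\mathbb P(\Omega_\gamma)>1-\gamma$ such that, on $\Omega_\gamma$, $|z_m-K|\le\eta e^{-\varsigma(m-\tau)}$ for all $m\ge\tau$, and $z_m\to K$ as $m\to\infty$; (ii) there exist a set $\Omega^{[1]}_\gamma$ with $\mathbb P(\Omega^{[1]}_\gamma)>1-\gamma$ and a nonrandom $n_0\in\mathbb N$ such that, on $\Omega^{[1]}_\gamma$, $|z_m-K|\le\eta e^{-\varsigma(m-n_0)}$ for all $m\ge n_0$.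
   Context: $(\Omega,\mathcal F,(\mathcal F_n)_{n\in\mathbb N},\mathbb P)$ is a complete filtered probability space and $\mathbb N_0=\mathbb N\cup\{0\}$. Function $f$: $f:[0,\infty)\to[0,\infty)$ is continuous with a unique positive fixed point $K>0$, and $(z-K)(f(z)-K)<0$ for $z\ne K$. There are fixed positive constants $u,q,C,\kappa$ such that $f(z)=K-(1+q)(z-K)+\phi(z-K)$ whenever $z\in(K-u,K+u)$, where $|\phi(x)|\le C|x|^{1+\kappa}$ for all $x\in(-u,u)$. Noise: each of the sequences $(\xi_n)_{n\in\mathbb N}$, $(\zeta_n)_{n\in\mathbb N}$, $(\chi_n)_{n\in\mathbb N}$ consists of identically distributed random variables; all the variables $\xi_n,\zeta_n,\chi_n$ are mutually independent and satisfy $|\xi_n|\le1$, $|\zeta_n|\le1$, $|\chi_n|\le1$. The noise intensity is a constant $\sigma>0$, and there exists $\lambda>0$ such that $\mathbf E\ln|1+q-\sigma\xi_n|=-\lambda<0$. Property (P) of positive constants $(\varsigma,\eta,\delta)$ (for the given $\gamma$): for every a.s. finite random variable $\tau:\Omega\to\mathbb N_0$ independent of the $\xi_i$, $i\in\mathbb N$, every solution of $z_{n+1}=f(z_n)+\sigma\xi_{n+1}(z_n-K)$, $n\ge\tau$, with $z_\tau\in(K-\delta,K+\delta)$, satisfies conclusions (i) and (ii) of the claim. (Here and in the claim, the recursion with noise $\xi$ is required only as long as $z_n$ stays in the domain $[0,\infty)$ of $f$.) Directed Walk Control (DWC) from $(K-u,K+u)$ to $(K-\delta,K+\delta)$: its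 parameters are $a>1$, $k\in\mathbb N$, $\ell>0$, $\ell_c>0$, nested intervals $J^{(0)}\supset J^{(1)}\supset\dots\supset J^{(k)}$ with $J^{(0)}=(K-u,K+u)$, $J^{(j)}=(K-a^{-j}u,K+a^{-j}u)$ for $1\le j\le k-1$, $J^{(k)}=(K-\delta,K+\delta)$, and positive numbers $\alpha_0,\dots,\alpha_{k-1}$ with $\alpha_j=a^{-1}\alpha_{j-1}$. The DWC equation is $$z_{n+1}=f(z_n)-\alpha_j(1+\ell_c\chi_{n+1})\frac{f(z_n)-K}{|f(z_n)-K|}+\ell\zeta_{n+1},\qquad z_n\in J^{(j)}\setminus J^{(j+1)},\ j=0,\dots,k-1,$$ applied until the solution enters $J^{(k)}$. The initial value $z_0$ is nonrandom. *)

theory Defs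
  imports "HOL-Probability.Probability"
begin

definition complete_filtered_prob_space :: "'a measure \<Rightarrow> (nat \<Rightarrow> 'a measure) \<Rightarrow> bool" where
  "complete_filtered_prob_space M F \<longleftrightarrow>
     prob_space M \<and> complete_measure M \<and>
     filtration (space M) F \<and> (\<forall>n. subalgebra M (F n))"

text \<open>Noise sequences are indexed by the positive integers; the value at index 0 is
  irrelevant.\<close>

definition noise_sequence :: "'a measure \<Rightarrow> (nat \<Rightarrow> 'a \<Rightarrow> real) \<Rightarrow> bool" where
  "noise_sequence M X \<longleftrightarrow>
     (\<forall>n\<ge>1. X n \<in> borel_measurable M) \<and>
     (\<forall>m\<ge>1. \<forall>n\<ge>1. distr M borel (X m) = distr M borel (X n)) \<and>
     (\<forall>n\<ge>1. AE \<omega> in M. \<bar>X n \<omega>\<bar> \<le> 1)"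

definition mutually_independent_noises ::
    "'a measure \<Rightarrow> (nat \<Rightarrow> 'a \<Rightarrow> real) \<Rightarrow> (nat \<Rightarrow> 'a \<Rightarrow> real) \<Rightarrow> (nat \<Rightarrow> 'a \<Rightarrow> real) \<Rightarrow> bool" where
  "mutually_independent_noises M \<xi> \<zeta> chi \<longleftrightarrow>
     prob_space.indep_vars M (\<lambda>_. borel) (\<lambda>(i, n). ([\<xi>, \<zeta>, chi] ! i) n) ({..<3} \<times> {1..})"

text \<open>The statement that the expectation of \<open>ln \<bar>X\<bar>\<close> is the finite number \<open>c\<close>. In the
  mathematical convention \<open>ln 0 = -\<infinity>\<close>, so finiteness of the expectation forces \<open>X \<noteq> 0\<close> almost
  surely; this has to be stated because HOL has \<open>ln 0 = 0\<close>.\<close>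

definition has_log_expectation :: "'a measure \<Rightarrow> ('a \<Rightarrow> real) \<Rightarrow> real \<Rightarrow> bool" where
  "has_log_expectation M X c \<longleftrightarrow>
     (AE \<omega> in M. X \<omega> \<noteq> 0) \<and>
     integrable M (\<lambda>\<omega>. ln \<bar>X \<omega>\<bar>) \<and>
     (\<integral>\<omega>. ln \<bar>X \<omega>\<bar> \<partial>M) = c"

text \<open>A random moment takes values in \<^typ>\<open>enat\<close>, the value \<open>\<infinity>\<close> being attained at most on a null
  set. It is independent of the noise if the sigma-algebra it generates is independent of the one
  generated by the whole sequence \<open>\<xi>\<^sub>1, \<xi>\<^sub>2, \<dots>\<close>.\<close>

definition as_finite_moment :: "'a measure \<Rightarrow> ('a \<Rightarrow> enat) \<Rightarrow> bool" where
  "as_finite_moment M \<tau> \<longleftrightarrow>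
     \<tau> \<in> measurable M (count_space UNIV) \<and> (AE \<omega> in M. \<tau> \<omega> \<noteq> \<infinity>)"

definition moment_indep_of_noise ::
    "'a measure \<Rightarrow> (nat \<Rightarrow> 'a \<Rightarrow> real) \<Rightarrow> ('a \<Rightarrow> enat) \<Rightarrow> bool" where
  "moment_indep_of_noise M \<xi> \<tau> \<longleftrightarrow>
     prob_space.indep_set M
       (sets (vimage_algebra (space M) \<tau> (count_space UNIV)))
       (sets (vimage_algebra (space M) (\<lambda>\<omega>. \<lambda>i\<in>{1..}. \<xi> i \<omega>) (Pi\<^sub>M {1..} (\<lambda>_. borel))))"

text \<open>Solutions of \<open>z\<^sub>n\<^sub>+\<^sub>1 = f z\<^sub>n + \<sigma> \<xi>\<^sub>n\<^sub>+\<^sub>1 (z\<^sub>n - K)\<close> for \<open>n \<ge> \<tau>\<close>. The recursion is imposed only as long as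
  the trajectory has not left the domain \<open>[0, \<infinity>)\<close> of \<open>f\<close>; the values before \<open>\<tau>\<close> are unconstrained.\<close>

definition noisy_solution_from ::
    "'a measure \<Rightarrow> (real \<Rightarrow> real) \<Rightarrow> real \<Rightarrow> real \<Rightarrow> (nat \<Rightarrow> 'a \<Rightarrow> real) \<Rightarrow> ('a \<Rightarrow> enat) \<Rightarrow>
     (nat \<Rightarrow> 'a \<Rightarrow> real) \<Rightarrow> bool" where
  "noisy_solution_from M f K \<sigma> \<xi> \<tau> z \<longleftrightarrow>
     (\<forall>n. z n \<in> borel_measurable M) \<and>
     (AE \<omega> in M. \<forall>n. \<tau> \<omega> \<le> enat n \<longrightarrow> (\<forall>m. \<tau> \<omega> \<le> enat m \<and> m \<le> n \<longrightarrow> 0 \<le> z m \<omega>) \<longrightarrow>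
        z (Suc n) \<omega> = f (z n \<omega>) + \<sigma> * \<xi> (Suc n) \<omega> * (z n \<omega> - K))"

definition decay_from_moment ::
    "'a measure \<Rightarrow> real \<Rightarrow> real \<Rightarrow> real \<Rightarrow> real \<Rightarrow> ('a \<Rightarrow> enat) \<Rightarrow> (nat \<Rightarrow> 'a \<Rightarrow> real) \<Rightarrow> bool" where
  "decay_from_moment M K \<gamma> \<rho> \<eta> \<tau> z \<longleftrightarrow>
     (\<exists>\<Omega>\<^sub>\<gamma>\<in>sets M. measure M \<Omega>\<^sub>\<gamma> > 1 - \<gamma> \<and>
        (\<forall>\<omega>\<in>\<Omega>\<^sub>\<gamma>.
           (\<forall>m. \<tau> \<omega> \<le> enat m \<longrightarrow>
              \<bar>z m \<omega> - K\<bar> \<le> \<eta> * exp (- \<rho> * (real m - real (the_enat (\<tau> \<omega>))))) \<and>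
           (\<lambda>m. z m \<omega>) \<longlonglongrightarrow> K))"

definition decay_from_nonrandom ::
    "'a measure \<Rightarrow> real \<Rightarrow> real \<Rightarrow> real \<Rightarrow> real \<Rightarrow> (nat \<Rightarrow> 'a \<Rightarrow> real) \<Rightarrow> bool" where
  "decay_from_nonrandom M K \<gamma> \<rho> \<eta> z \<longleftrightarrow>
     (\<exists>\<Omega>\<^sub>\<gamma>\<in>sets M. \<exists>n\<^sub>0\<ge>1. measure M \<Omega>\<^sub>\<gamma> > 1 - \<gamma> \<and>
        (\<forall>\<omega>\<in>\<Omega>\<^sub>\<gamma>. \<forall>m\<ge>n\<^sub>0. \<bar>z m \<omega> - K\<bar> \<le> \<eta> * exp (- \<rho> * (real m - real n\<^sub>0))))"

definition property_P ::
    "'a measure \<Rightarrow> (real \<Rightarrow> real) \<Rightarrow> real \<Rightarrow> real \<Rightarrow> (nat \<Rightarrow> 'a \<Rightarrow> real) \<Rightarrow> real \<Rightarrow>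
     real \<Rightarrow> real \<Rightarrow> real \<Rightarrow> bool" where
  "property_P M f K \<sigma> \<xi> \<gamma> \<rho> \<eta> \<delta> \<longleftrightarrow>
     (\<forall>\<tau> z. as_finite_moment M \<tau> \<longrightarrow> moment_indep_of_noise M \<xi> \<tau> \<longrightarrow>
        noisy_solution_from M f K \<sigma> \<xi> \<tau> z \<longrightarrow>
        (AE \<omega> in M. z (the_enat (\<tau> \<omega>)) \<omega> \<in> {K - \<delta><..<K + \<delta>}) \<longrightarrow>
        decay_from_moment M K \<gamma> \<rho> \<eta> \<tau> z \<and> decay_from_nonrandom M K \<gamma> \<rho> \<eta> z)"

text \<open>The formula for \<open>1 \<le> j < k\<close> also covers \<open>j = 0\<close>, since \<open>k \<ge> 1\<close>.\<close>

definition dwc_interval :: "real \<Rightarrow> real \<Rightarrow> real \<Rightarrow> real \<Rightarrow> nat \<Rightarrow> nat \<Rightarrow> real set" where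
  "dwc_interval K u \<delta> a k j =
     (if j = k then {K - \<delta><..<K + \<delta>} else {K - u / a ^ j<..<K + u / a ^ j})"

definition dwc_parameters ::
    "real \<Rightarrow> real \<Rightarrow> real \<Rightarrow> real \<Rightarrow> nat \<Rightarrow> real \<Rightarrow> real \<Rightarrow> (nat \<Rightarrow> real) \<Rightarrow> bool" where
  "dwc_parameters K u \<delta> a k l l\<^sub>c \<alpha> \<longleftrightarrow>
     1 < a \<and> 1 \<le> k \<and> 0 < l \<and> 0 < l\<^sub>c \<and>
     (\<forall>j<k. dwc_interval K u \<delta> a k (Suc j) \<subset> dwc_interval K u \<delta> a k j) \<and>
     (\<forall>j<k. 0 < \<alpha> j) \<and>
     (\<forall>j. Suc j < k \<longrightarrow> \<alpha> (Suc j) = \<alpha> j / a)"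

definition dwc_solution ::
    "'a measure \<Rightarrow> (real \<Rightarrow> real) \<Rightarrow> real \<Rightarrow> real \<Rightarrow> real \<Rightarrow> real \<Rightarrow> nat \<Rightarrow> real \<Rightarrow> real \<Rightarrow> (nat \<Rightarrow> real) \<Rightarrow>
     (nat \<Rightarrow> 'a \<Rightarrow> real) \<Rightarrow> (nat \<Rightarrow> 'a \<Rightarrow> real) \<Rightarrow> real \<Rightarrow> (nat \<Rightarrow> 'a \<Rightarrow> real) \<Rightarrow> bool" where
  "dwc_solution M f K u \<delta> a k l l\<^sub>c \<alpha> \<zeta> chi x\<^sub>0 z \<longleftrightarrow>
     (\<forall>n. z n \<in> borel_measurable M) \<and>
     (AE \<omega> in M. z 0 \<omega> = x\<^sub>0 \<and>
        (\<forall>n. (\<forall>m\<le>n. z m \<omega> \<notin> dwc_interval K u \<delta> a k k) \<longrightarrow>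
           (\<forall>j<k. z n \<omega> \<in> dwc_interval K u \<delta> a k j - dwc_interval K u \<delta> a k (Suc j) \<longrightarrow>
              z (Suc n) \<omega> = f (z n \<omega>)
                - \<alpha> j * (1 + l\<^sub>c * chi (Suc n) \<omega>) * ((f (z n \<omega>) - K) / \<bar>f (z n \<omega>) - K\<bar>)
                + l * \<zeta> (Suc n) \<omega>)))"

text \<open>The infimum of the empty set is \<open>\<infinity>\<close>.\<close>

definition entry_moment :: "real set \<Rightarrow> (nat \<Rightarrow> 'a \<Rightarrow> real) \<Rightarrow> 'a \<Rightarrow> enat" where
  "entry_moment S z \<omega> = Inf {enat n |n. z n \<omega> \<in> S}"

end

theory Submission
  imports Defs
begin

text \<open>Near \<open>K\<close> one noisy step multiplies \<open>\<bar>z - K\<bar>\<close> by at most \<open>\<bar>1 + q - \<sigma> \<xi>\<bar> + \<epsilon>\<close>, and for small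
  \<open>\<epsilon>\<close> the logarithm of this factor is bounded with negative mean, so that after adding a small
  rate \<open>\<rho>\<close> some exponential moment is below \<open>1\<close>. By Markov's inequality and a union bound, all
  partial sums of the shifted logarithms stay below a constant \<open>L\<close> outside an event of probability
  \<open>\<gamma> / 2\<close>, whatever the index at which the sum starts, hence also from an independent random
  moment. Starting closer to \<open>K\<close> than \<open>exp (- L)\<close> times the size of the linear regime, the
  solution never leaves that regime.

  For the walk, \<open>C u\<^sup>\<kappa> < 1/2\<close> puts \<open>\<bar>f z - K\<bar>\<close> within \<open>\<bar>z - K\<bar> / 2\<close> of \<open>(1 + q) \<bar>z - K\<bar>\<close>. With
  \<open>\<alpha>\<^sub>j = (1 + q) u / a\<^sup>j\<close>, with \<open>a\<close> close to \<open>1\<close> and with small intensities, every step moves at least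
  one level inwards, so the target is reached after at most \<open>k\<close> steps. Up to a null set the entry
  moment is a function of \<open>\<zeta>\<close> and \<open>\<chi>\<close> only, hence independent of \<open>\<xi>\<close>.\<close>

subsection \<open>Partial sums of independent variables with negative mean\<close>

text \<open>For negative \<open>x = - y\<close>, the product of \<open>1 - y + y^2\<close> with the
  quadratic Taylor lower bound of \<open>exp y\<close> has no linear term and is at least 1;
  dividing by \<open>exp y\<close> gives the estimate.\<close>

lemma exp_le_quadratic:
  fixes x :: real
  assumes "x \<le> 1"
  shows "exp x \<le> 1 + x + x\<^sup>2"
proof (cases "0 \<le> x")
  case True
  then show ?thesis using assms exp_bound by blast
next
  case False
  define y where "y = - x"
  have y: "0 \<le> y" using False by (simp add: y_def)
  have "1 \<le> (1 - y + y\<^sup>2) * (1 + y + y\<^sup>2 / 2)"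
  proof -
    have "(1 - y + y\<^sup>2) * (1 + y + y\<^sup>2 / 2) = 1 + y\<^sup>2 / 2 + y ^ 3 / 2 + y ^ 4 / 2"
      by (simp add: field_simps power2_eq_square power3_eq_cube power4_eq_xxxx)
    then show ?thesis using y by simp
  qed
  also have "\<dots> \<le> (1 - y + y\<^sup>2) * exp y"
  proof (rule mult_left_mono[OF exp_lower_Taylor_quadratic[OF y]])
    have "0 \<le> (1 - y)\<^sup>2 + y" using y by simp
    then show "0 \<le> 1 - y + y\<^sup>2" using y by (simp add: power2_eq_square algebra_simps)
  qed
  finally have "exp (- y) \<le> 1 - y + y\<^sup>2"
    by (simp add: exp_minus field_simps)
  then show ?thesis by (simp add: y_def)
qed

text \<open>To first order the exponential moment is \<open>1 + t * expectation Y\<close>, and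
  boundedness of \<open>Y\<close> makes the remainder quadratic in \<open>t\<close>, so the negative
  linear term wins for small \<open>t\<close>.\<close>

lemma (in prob_space) exp_moment_less_one:
  assumes [measurable]: "random_variable borel Y"
    and bounded: "AE \<omega> in M. \<bar>Y \<omega>\<bar> \<le> B"
    and mean: "expectation Y < 0"
  obtains t :: real where "0 < t" "expectation (\<lambda>\<omega>. exp (t * Y \<omega>)) < 1"
    "integrable M (\<lambda>\<omega>. exp (t * Y \<omega>))"
proof
  define m where "m = - expectation Y"
  define B' where "B' = max B 1"
  \<comment> \<open>The first bound gives \<open>t * Y \<le> 1\<close>, as the quadratic estimate
    requires; the second makes the quadratic remainder at most half of the gain
    \<open>t * m\<close>.\<close>
  define t where "t = min (1 / B') (m / (2 * B'\<^sup>2))"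
  have m: "0 < m" using mean by (simp add: m_def)
  have B': "1 \<le> B'" "B \<le> B'" by (auto simp: B'_def)
  show t: "0 < t" using m B' by (simp add: t_def)
  have bd: "AE \<omega> in M. exp (t * Y \<omega>) \<le> 1 + t * Y \<omega> + t\<^sup>2 * B'\<^sup>2"
    using bounded
  proof eventually_elim
    case (elim \<omega>)
    have Y: "\<bar>Y \<omega>\<bar> \<le> B'" using elim B' by simp
    have "t * Y \<omega> \<le> t * B'" using Y t by (intro mult_left_mono) auto
    also have "\<dots> \<le> (1 / B') * B'" using B' by (intro mult_right_mono) (auto simp: t_def)
    also have "\<dots> = 1" using B' by simp
    finally have "exp (t * Y \<omega>) \<le> 1 + t * Y \<omega> + (t * Y \<omega>)\<^sup>2" by (rule exp_le_quadratic)
    moreover have "(Y \<omega>)\<^sup>2 \<le> B'\<^sup>2" using Y by (metis abs_ge_zero abs_le_square_iff abs_of_nonneg order_trans)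
    then have "(t * Y \<omega>)\<^sup>2 \<le> t\<^sup>2 * B'\<^sup>2" by (simp add: power_mult_distrib mult_left_mono)
    ultimately show ?case by simp
  qed
  have int_Y: "integrable M Y"
    using bounded by (intro integrable_const_bound[where B = B]) auto
  show int: "integrable M (\<lambda>\<omega>. exp (t * Y \<omega>))"
  proof (rule Bochner_Integration.integrable_bound)
    show "integrable M (\<lambda>\<omega>. 1 + t * Y \<omega> + t\<^sup>2 * B'\<^sup>2)" using int_Y by simp
    show "AE \<omega> in M. norm (exp (t * Y \<omega>)) \<le> norm (1 + t * Y \<omega> + t\<^sup>2 * B'\<^sup>2)"
      using bd by eventually_elim (smt (verit) exp_gt_zero real_norm_def)
  qed simp
  have "expectation (\<lambda>\<omega>. exp (t * Y \<omega>)) \<le> expectation (\<lambda>\<omega>. 1 + t * Y \<omega> + t\<^sup>2 * B'\<^sup>2)"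
    using int int_Y bd by (intro integral_mono_AE) auto
  also have "\<dots> = 1 - t * m + t * (t * B'\<^sup>2)"
    using int_Y by (simp add: m_def prob_space power2_eq_square)
  also have "t * B'\<^sup>2 \<le> m / (2 * B'\<^sup>2) * B'\<^sup>2"
    using B' by (intro mult_right_mono) (auto simp: t_def)
  also have "\<dots> = m / 2" using B' by simp
  finally have "expectation (\<lambda>\<omega>. exp (t * Y \<omega>)) \<le> 1 - t * m + t * (m / 2)"
    using t by (simp add: mult_left_mono)
  also have "\<dots> < 1" using t m by (simp add: field_simps)
  finally show "expectation (\<lambda>\<omega>. exp (t * Y \<omega>)) < 1" .
qed

text \<open>A Chernoff bound: independence turns the exponential moment of a sum of \<open>n\<close>
  terms into \<open>r ^ n\<close>, and summing Markov's bounds over \<open>n\<close> gives a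
  geometric series. The bound does not depend on the starting index \<open>k\<close>, which later
  permits a random start.\<close>

lemma (in prob_space) prob_ex_partial_sum_gt:
  fixes Y :: "nat \<Rightarrow> 'a \<Rightarrow> real"
  assumes indep: "indep_vars (\<lambda>_. borel) Y {1..}"
    and t: "0 < t"
    and int: "\<And>i. 1 \<le> i \<Longrightarrow> integrable M (\<lambda>\<omega>. exp (t * Y i \<omega>))"
    and r: "\<And>i. 1 \<le> i \<Longrightarrow> expectation (\<lambda>\<omega>. exp (t * Y i \<omega>)) = r" "r < 1"
  shows "prob {\<omega> \<in> space M. \<exists>n. L < (\<Sum>i\<in>{k<..k + n}. Y i \<omega>)} \<le> exp (- t * L) / (1 - r)"
proof -
  have meas[measurable]: "Y i \<in> borel_measurable M" if "1 \<le> i" for i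
    using indep that by (auto simp: indep_vars_def)
  define A where "A n = {\<omega> \<in> space M. L < (\<Sum>i\<in>{k<..k + n}. Y i \<omega>)}" for n
  have A_meas[measurable]: "A n \<in> sets M" for n
    unfolding A_def by measurable
  have r0: "0 \<le> r" using r(1)[of 1] by (metis order_refl exp_ge_zero integral_nonneg_AE AE_I2)
  have A: "prob (A n) \<le> exp (- t * L) * r ^ n" for n
  proof -
    let ?I = "{k<..k + n}"
    have ind: "indep_vars (\<lambda>_. borel) (\<lambda>i \<omega>. exp (t * Y i \<omega>)) ?I"
      by (rule indep_vars_compose2[OF indep_vars_subset[OF indep]]) auto
    have prod: "exp (t * (\<Sum>i\<in>?I. Y i \<omega>)) = (\<Prod>i\<in>?I. exp (t * Y i \<omega>))" for \<omega>
      by (simp add: sum_distrib_left exp_sum)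
    have int_prod: "integrable M (\<lambda>\<omega>. \<Prod>i\<in>?I. exp (t * Y i \<omega>))"
      using ind int by (intro indep_vars_integrable) auto
    have "expectation (\<lambda>\<omega>. \<Prod>i\<in>?I. exp (t * Y i \<omega>)) = (\<Prod>i\<in>?I. expectation (\<lambda>\<omega>. exp (t * Y i \<omega>)))"
      using ind int by (intro indep_vars_lebesgue_integral) auto
    also have "\<dots> = r ^ n" using r(1) by simp
    finally have E: "expectation (\<lambda>\<omega>. \<Prod>i\<in>?I. exp (t * Y i \<omega>)) = r ^ n" .
    have "prob (A n) \<le> prob {\<omega> \<in> space M. exp (t * L) \<le> (\<Prod>i\<in>?I. exp (t * Y i \<omega>))}"
    proof (rule finite_measure_mono)
      show "{\<omega> \<in> space M. exp (t * L) \<le> (\<Prod>i\<in>?I. exp (t * Y i \<omega>))} \<in> sets M"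
        by measurable
    qed (use t in \<open>auto simp: A_def simp flip: prod\<close>)
    also have "\<dots> \<le> r ^ n / exp (t * L)"
      unfolding E[symmetric]
      by (rule integral_Markov_inequality_measure[OF int_prod, of "{}"]) (auto intro!: prod_nonneg)
    finally show ?thesis by (simp add: exp_minus field_simps)
  qed
  have geo: "summable (\<lambda>n. exp (- t * L) * r ^ n)"
    using r0 r(2) by (intro summable_mult summable_geometric) auto
  have summ: "summable (\<lambda>n. prob (A n))"
    using A by (intro summable_comparison_test'[OF geo, where N = 0]) auto
  have "prob (\<Union>n. A n) \<le> (\<Sum>n. prob (A n))"
    by (intro finite_measure_subadditive_countably summ) auto
  also have "\<dots> \<le> (\<Sum>n. exp (- t * L) * r ^ n)"
    by (intro suminf_le A summ geo)
  also have "\<dots> = exp (- t * L) / (1 - r)"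
    using r0 r(2) by (simp add: suminf_mult suminf_geometric divide_inverse)
  also have "(\<Union>n. A n) = {\<omega> \<in> space M. \<exists>n. L < (\<Sum>i\<in>{k<..k + n}. Y i \<omega>)}"
    by (auto simp: A_def)
  finally show ?thesis .
qed

text \<open>As \<epsilon> tends to 0 the perturbed logarithms converge to
  \<open>ln \<bar>X\<bar>\<close>, and dominated convergence carries the strict sign of the mean
  over. The added \<epsilon> will both absorb the nonlinear remainder of \<open>f\<close> and bound
  the logarithm from below.\<close>

lemma ex_log_perturbation_negative:
  assumes "prob_space M" and [measurable]: "X \<in> borel_measurable M"
    and bounded: "AE \<omega> in M. \<bar>X \<omega>\<bar> \<le> B"
    and log_mean: "has_log_expectation M X c" "c < 0"
  obtains \<epsilon> :: real where "0 < \<epsilon>" "(\<integral>\<omega>. ln (\<bar>X \<omega>\<bar> + \<epsilon>) \<partial>M) < 0"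
proof -
  interpret prob_space M by fact
  define s :: "nat \<Rightarrow> 'a \<Rightarrow> real" where "s n \<omega> = ln (\<bar>X \<omega>\<bar> + 1 / real (Suc n))" for n \<omega>
  have nz: "AE \<omega> in M. X \<omega> \<noteq> 0" and int: "integrable M (\<lambda>\<omega>. ln \<bar>X \<omega>\<bar>)"
    and mean: "(\<integral>\<omega>. ln \<bar>X \<omega>\<bar> \<partial>M) = c"
    using log_mean by (auto simp: has_log_expectation_def)
  have "(\<lambda>n. expectation (s n)) \<longlonglongrightarrow> expectation (\<lambda>\<omega>. ln \<bar>X \<omega>\<bar>)"
  \<comment> \<open>Each \<open>s n\<close> lies between \<open>ln \<bar>X\<bar>\<close>, which is
    integrable, and the constant \<open>ln (\<bar>B\<bar> + 1)\<close>, because the perturbation is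
    at most 1.\<close>
  proof (rule integral_dominated_convergence[where w = "\<lambda>\<omega>. \<bar>ln \<bar>X \<omega>\<bar>\<bar> + ln (\<bar>B\<bar> + 1)"])
    show "AE \<omega> in M. (\<lambda>n. s n \<omega>) \<longlonglongrightarrow> ln \<bar>X \<omega>\<bar>"
      using nz
    proof eventually_elim
      case (elim \<omega>)
      have "(\<lambda>n. \<bar>X \<omega>\<bar> + 1 / real (Suc n)) \<longlonglongrightarrow> \<bar>X \<omega>\<bar> + 0"
        by (intro tendsto_intros LIMSEQ_Suc lim_1_over_n)
      then show ?case unfolding s_def using elim by (intro tendsto_ln) auto
    qed
    show "AE \<omega> in M. norm (s n \<omega>) \<le> \<bar>ln \<bar>X \<omega>\<bar>\<bar> + ln (\<bar>B\<bar> + 1)" for n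
      using nz bounded
    proof eventually_elim
      case (elim \<omega>)
      have le1: "1 / real (Suc n) \<le> 1" by simp
      have "ln \<bar>X \<omega>\<bar> \<le> s n \<omega>" unfolding s_def using elim by (subst ln_le_cancel_iff) (auto intro: add_pos_pos)
      moreover have "s n \<omega> \<le> ln (\<bar>B\<bar> + 1)" unfolding s_def using elim le1
        by (subst ln_le_cancel_iff) (auto intro!: add_pos_pos add_mono)
      moreover have "0 \<le> ln (\<bar>B\<bar> + 1)" by simp
      ultimately show ?case unfolding real_norm_def by linarith
    qed
    show "s n \<in> borel_measurable M" for n unfolding s_def by measurable
  qed (use int in auto)
  then have "\<forall>\<^sub>F n in sequentially. expectation (s n) < 0"
    using log_mean(2) mean by (intro order_tendstoD(2)) auto
  then obtain n where "expectation (s n) < 0" by (auto simp: eventually_sequentially)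
  then show ?thesis
    by (intro that[of "1 / real (Suc n)"]) (auto simp: s_def[abs_def])
qed

subsection \<open>Independent random moments\<close>

lemma (in prob_space) indep_vars_reindex:
  assumes indep: "indep_vars M' X (h ` I)" and inj: "inj_on h I"
  shows "indep_vars (\<lambda>i. M' (h i)) (\<lambda>i. X (h i)) I"
  unfolding indep_vars_def
proof (intro conjI ballI indep_setsI)
  let ?S = "\<lambda>j. sigma_sets (space M) {X j -` A \<inter> space M |A. A \<in> sets (M' j)}"
  have ind: "indep_sets ?S (h ` I)" and X: "\<And>i. i \<in> I \<Longrightarrow> random_variable (M' (h i)) (X (h i))"
    using indep by (auto simp: indep_vars_def)
  fix i assume "i \<in> I"
  then show "random_variable (M' (h i)) (X (h i))" "?S (h i) \<subseteq> events"
    using X ind by (auto simp: indep_sets_def)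
next
  let ?S = "\<lambda>j. sigma_sets (space M) {X j -` A \<inter> space M |A. A \<in> sets (M' j)}"
  have ind: "indep_sets ?S (h ` I)" using indep by (auto simp: indep_vars_def)
  fix A J assume J: "J \<noteq> {}" "J \<subseteq> I" "finite J" and A: "\<forall>j\<in>J. A j \<in> ?S (h j)"
  have inj_J: "inj_on h J" using inj J(2) by (rule inj_on_subset)
  define B where "B = A \<circ> the_inv_into J h"
  have B: "B (h j) = A j" if "j \<in> J" for j
    using that inj_J by (simp add: B_def the_inv_into_f_f)
  have "prob (\<Inter>j\<in>h ` J. B j) = (\<Prod>j\<in>h ` J. prob (B j))"
    using J A B by (intro indep_setsD[OF ind]) auto
  then show "prob (\<Inter>j\<in>J. A j) = (\<Prod>j\<in>J. prob (A j))"
    using inj_J B by (simp add: prod.reindex)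
qed

text \<open>Conditioning on the value of \<tau>: independence bounds each piece by \<open>c\<close>
  times the probability of \<open>\<tau> = k\<close>, and these disjoint events have total
  probability at most 1. The value \<open>\<infinity>\<close> contributes nothing to the
  union.\<close>

lemma (in prob_space) prob_at_independent_moment_le:
  fixes \<tau> :: "'a \<Rightarrow> enat"
  assumes [measurable]: "\<tau> \<in> measurable M (count_space UNIV)"
    and indep: "indep_set (sets (vimage_algebra (space M) \<tau> (count_space UNIV))) \<B>"
    and A: "\<And>k. A k \<in> \<B>" "\<And>k. prob (A k) \<le> c"
  shows "prob (\<Union>k. {\<omega> \<in> space M. \<tau> \<omega> = enat k} \<inter> A k) \<le> c"
proof -
  define T where "T k = {\<omega> \<in> space M. \<tau> \<omega> = enat k}" for k
  have A_meas: "A k \<in> events" for k using indep_setD_ev2[OF indep] A(1) by auto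
  have T_meas: "T k \<in> events" for k unfolding T_def by measurable
  have "T k = \<tau> -` {enat k} \<inter> space M" for k by (auto simp: T_def)
  then have "T k \<in> sets (vimage_algebra (space M) \<tau> (count_space UNIV))" for k
    by (simp add: in_vimage_algebra)
  then have eq: "prob (T k \<inter> A k) = prob (T k) * prob (A k)" for k
    by (intro indep_setD[OF indep] A(1))
  have c: "0 \<le> c" using A(2)[of 0] measure_nonneg[of M] by (rule order_trans[rotated])
  have disj: "disjoint_family T" by (auto simp: disjoint_family_on_def T_def)
  have T_sums: "(\<lambda>k. prob (T k)) sums prob (\<Union>k. T k)"
    using T_meas by (intro finite_measure_UNION disj) auto
  have "(\<lambda>k. prob (T k \<inter> A k)) sums prob (\<Union>k. T k \<inter> A k)"
    using T_meas A_meas by (intro finite_measure_UNION) (auto simp: disjoint_family_on_def T_def)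
  moreover have "(\<lambda>k. prob (T k) * c) sums (prob (\<Union>k. T k) * c)"
    by (intro sums_mult2 T_sums)
  ultimately have "prob (\<Union>k. T k \<inter> A k) \<le> prob (\<Union>k. T k) * c"
    by (rule sums_le[rotated]) (use A(2) in \<open>auto simp: eq intro: mult_left_mono\<close>)
  also have "\<dots> \<le> c" using c by (intro mult_left_le_one_le) auto
  finally show ?thesis by (simp add: T_def)
qed

subsection \<open>Exponential decay under the noise\<close>

text \<open>A pathwise bootstrap: the multiplicative bound holds only while the path stays below
  \<theta>, and the bound on the sums keeps it below \<open>\<delta> * exp L < \<theta>\<close>, so
  the next step is again covered.\<close>

lemma random_multiplier_decay:
  fixes x y :: "nat \<Rightarrow> real"
  assumes step: "\<And>n. k \<le> n \<Longrightarrow> \<forall>m\<in>{k..n}. \<bar>x m\<bar> < \<theta> \<Longrightarrow> \<bar>x (Suc n)\<bar> \<le> \<bar>x n\<bar> * exp (y (Suc n))"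
    and init: "\<bar>x k\<bar> \<le> \<delta>" "\<delta> * exp L < \<theta>"
    and sums: "\<And>n. (\<Sum>i\<in>{k<..k + n}. y i + \<rho>) \<le> L" and "0 \<le> \<rho>"
  shows "\<bar>x (k + n)\<bar> \<le> \<delta> * exp L * exp (- \<rho> * real n)"
proof -
  \<comment> \<open>The shift \<rho> occurs \<open>n\<close> times in the sum bounded by
    \<open>L\<close>; removing it produces the decay rate.\<close>
  have bound: "\<delta> * exp (\<Sum>i\<in>{k<..k + n}. y i) \<le> \<delta> * exp L * exp (- \<rho> * real n)" for n
  proof -
    have "exp (\<Sum>i\<in>{k<..k + n}. y i) \<le> exp (L - \<rho> * real n)"
      using sums[of n] by (simp add: sum.distrib mult.commute)
    then have "\<delta> * exp (\<Sum>i\<in>{k<..k + n}. y i) \<le> \<delta> * exp (L - \<rho> * real n)"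
      using init(1) by (intro mult_left_mono) auto
    then show ?thesis by (simp add: mult.assoc flip: exp_add)
  qed
  have "\<bar>x (k + n)\<bar> \<le> \<delta> * exp (\<Sum>i\<in>{k<..k + n}. y i)" for n
  proof (induction n rule: less_induct)
    case (less n)
    show ?case
    proof (cases n)
      case 0
      then show ?thesis using init by simp
    next
      case (Suc j)
      have "\<bar>x m\<bar> < \<theta>" if "m \<in> {k..k + j}" for m
      proof -
        have "\<bar>x (k + (m - k))\<bar> \<le> \<delta> * exp (\<Sum>i\<in>{k<..k + (m - k)}. y i)"
          using that Suc by (intro less.IH) auto
        also have "\<dots> \<le> \<delta> * exp L * exp (- \<rho> * real (m - k))" by (rule bound)
        also have "\<dots> \<le> \<delta> * exp L * 1"
          using init(1) \<open>0 \<le> \<rho>\<close> by (intro mult_left_mono) auto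
        finally show ?thesis using that init(2) by simp
      qed
      then have "\<bar>x (Suc (k + j))\<bar> \<le> \<bar>x (k + j)\<bar> * exp (y (Suc (k + j)))"
        by (intro step) auto
      also have "\<dots> \<le> \<delta> * exp (\<Sum>i\<in>{k<..k + j}. y i) * exp (y (Suc (k + j)))"
        using less.IH[of j] Suc by (intro mult_right_mono) auto
      also have "\<dots> = \<delta> * exp (\<Sum>i\<in>{k<..k + n}. y i)"
      proof -
        have "{k<..k + n} = insert (Suc (k + j)) {k<..k + j}" using Suc by auto
        then show ?thesis by (simp add: exp_add)
      qed
      finally show ?thesis by (simp add: Suc)
    qed
  qed
  then show ?thesis using bound order_trans by blast
qed

text \<open>The constants are uniform over all \<delta> up to \<open>\<delta>\<^sub>0\<close>. This
  leaves the freedom to fit \<delta> to the levels of the walk afterwards.\<close>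

lemma ex_property_P:
  fixes M :: "'a measure"
  assumes "prob_space M"
    and domain: "{K - u<..<K + u} \<subseteq> {0..}"
    and expansion: "\<And>x. x \<in> {K - u<..<K + u} \<Longrightarrow> f x = K - (1 + q) * (x - K) + \<phi> (x - K)"
    and phi_bound: "\<And>x. x \<in> {- u<..<u} \<Longrightarrow> \<bar>\<phi> x\<bar> \<le> C * \<bar>x\<bar> powr (1 + \<kappa>)"
    and pos: "0 < u" "0 < q" "0 < C" "0 < \<kappa>" "0 < \<sigma>" "0 < lam" "0 < \<gamma>"
    and noise: "noise_sequence M \<xi>"
    and indep: "prob_space.indep_vars M (\<lambda>_. borel) \<xi> {1..}"
    and log_mean: "has_log_expectation M (\<lambda>\<omega>. 1 + q - \<sigma> * \<xi> 1 \<omega>) (- lam)"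
  obtains \<rho> \<eta> \<delta>\<^sub>0 where "0 < \<rho>" "0 < \<eta>" "0 < \<delta>\<^sub>0"
    "\<And>\<delta>. \<delta> \<le> \<delta>\<^sub>0 \<Longrightarrow> property_P M f K \<sigma> \<xi> \<gamma> \<rho> \<eta> \<delta>"
proof -
  interpret prob_space M by fact
  define B where "B = 1 + q + \<sigma>"
  have \<xi>_meas[measurable]: "\<xi> i \<in> borel_measurable M" if "1 \<le> i" for i
    using noise that by (auto simp: noise_sequence_def)
  have W_bound: "AE \<omega> in M. \<bar>1 + q - \<sigma> * \<xi> 1 \<omega>\<bar> \<le> B"
  proof -
    have "AE \<omega> in M. \<bar>\<xi> 1 \<omega>\<bar> \<le> 1" using noise by (auto simp: noise_sequence_def)
    then show ?thesis
    proof eventually_elim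
      case (elim \<omega>)
      have "\<bar>\<sigma> * \<xi> 1 \<omega>\<bar> \<le> \<sigma> * 1" unfolding abs_mult using elim pos by (intro mult_mono) auto
      then show ?case using pos by (auto simp: B_def)
    qed
  qed
  obtain \<epsilon> where \<epsilon>: "0 < \<epsilon>" and neg: "(\<integral>\<omega>. ln (\<bar>1 + q - \<sigma> * \<xi> 1 \<omega>\<bar> + \<epsilon>) \<partial>M) < 0"
    using ex_log_perturbation_negative[OF assms(1) _ W_bound log_mean] pos by auto
  \<comment> \<open>The logarithm of the factor that bounds one step in the linear regime. Thanks to
    \<epsilon> it is bounded below by \<open>ln \<epsilon>\<close>.\<close>
  define y where "y i \<omega> = ln (\<bar>1 + q - \<sigma> * \<xi> i \<omega>\<bar> + \<epsilon>)" for i \<omega>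
  have y_meas[measurable]: "y i \<in> borel_measurable M" if "1 \<le> i" for i
    using that unfolding y_def by measurable
  have y_bound: "AE \<omega> in M. \<bar>y 1 \<omega>\<bar> \<le> \<bar>ln \<epsilon>\<bar> + \<bar>ln (B + \<epsilon>)\<bar>"
    using W_bound
  proof eventually_elim
    case (elim \<omega>)
    have "ln \<epsilon> \<le> y 1 \<omega>" "y 1 \<omega> \<le> ln (B + \<epsilon>)"
      using elim \<epsilon> by (auto simp: y_def intro!: ln_mono)
    then show ?case by linarith
  qed
  have y_int: "integrable M (y 1)"
    using y_bound by (intro integrable_const_bound) auto
  \<comment> \<open>Half of the available drift becomes the decay rate; the shifted variable keeps
    the mean \<open>- \<rho>\<close>.\<close>
  define \<rho> where "\<rho> = - expectation (y 1) / 2"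
  have \<rho>: "0 < \<rho>" using neg by (simp add: \<rho>_def y_def[abs_def])
  have shifted: "expectation (\<lambda>\<omega>. y 1 \<omega> + \<rho>) < 0"
    using y_int \<rho> by (simp add: prob_space \<rho>_def)
  have shifted_bound: "AE \<omega> in M. \<bar>y 1 \<omega> + \<rho>\<bar> \<le> \<bar>ln \<epsilon>\<bar> + \<bar>ln (B + \<epsilon>)\<bar> + \<rho>"
    using y_bound by eventually_elim (use \<rho> in linarith)
  obtain t where t: "0 < t" and r: "expectation (\<lambda>\<omega>. exp (t * (y 1 \<omega> + \<rho>))) < 1"
    and r_int: "integrable M (\<lambda>\<omega>. exp (t * (y 1 \<omega> + \<rho>)))"
    using exp_moment_less_one[OF _ shifted_bound shifted] by auto
  define r where "r = expectation (\<lambda>\<omega>. exp (t * (y 1 \<omega> + \<rho>)))"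
  \<comment> \<open>Writing the exponential as a fixed function of the noise lets the equality of
    distributions transfer its integrability and its mean \<open>r\<close> from index 1 to every
    index.\<close>
  define g where "g x = exp (t * (ln (\<bar>1 + q - \<sigma> * x\<bar> + \<epsilon>) + \<rho>))" for x
  have [measurable]: "g \<in> borel_measurable borel" unfolding g_def by measurable
  have identical: "integrable M (\<lambda>\<omega>. exp (t * (y i \<omega> + \<rho>)))"
    "expectation (\<lambda>\<omega>. exp (t * (y i \<omega> + \<rho>))) = r" if i: "1 \<le> i" for i
  proof -
    have distr: "distr M borel (\<xi> i) = distr M borel (\<xi> 1)"
      using noise i unfolding noise_sequence_def by blast
    have "integrable (distr M borel (\<xi> 1)) g"
      using r_int by (subst integrable_distr_eq) (auto simp: g_def y_def)
    then show "integrable M (\<lambda>\<omega>. exp (t * (y i \<omega> + \<rho>)))"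
      unfolding distr[symmetric] using i by (subst (asm) integrable_distr_eq) (auto simp: g_def y_def)
    have "(\<integral>x. g x \<partial>distr M borel (\<xi> 1)) = r"
      by (subst integral_distr) (auto simp: g_def y_def r_def)
    then show "expectation (\<lambda>\<omega>. exp (t * (y i \<omega> + \<rho>))) = r"
      unfolding distr[symmetric] using i by (subst (asm) integral_distr) (auto simp: g_def y_def)
  qed
  \<comment> \<open>Solves \<open>exp (- t * L) / (1 - r) = \<gamma> / 2\<close>; the left side is
    the Chernoff bound above.\<close>
  define L where "L = - ln (\<gamma> / 2 * (1 - r)) / t"
  define \<Xi> where "\<Xi> \<omega> = (\<lambda>i\<in>{1..}. \<xi> i \<omega>)" for \<omega>
  define A where "A k = {\<omega> \<in> space M. \<exists>n. L < (\<Sum>i\<in>{k<..k + n}. y i \<omega> + \<rho>)}" for k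
  have A_prob: "prob (A k) \<le> \<gamma> / 2" for k
  proof -
    have r1: "r < 1" using r by (simp add: r_def)
    have "indep_vars (\<lambda>_. borel) (\<lambda>i \<omega>. y i \<omega> + \<rho>) {1..}"
      unfolding y_def by (rule indep_vars_compose2[OF indep]) auto
    from prob_ex_partial_sum_gt[OF this t identical r1]
    have "prob (A k) \<le> exp (- t * L) / (1 - r)" unfolding A_def by simp
    also have "exp (- t * L) = \<gamma> / 2 * (1 - r)"
      using t r1 pos by (simp add: L_def)
    also have "\<gamma> / 2 * (1 - r) / (1 - r) = \<gamma> / 2"
      using r1 by (intro nonzero_mult_div_cancel_right) simp
    finally show ?thesis .
  qed
  \<comment> \<open>Independence of \<tau> is formulated for the sigma-algebra generated by the
    whole noise sequence, so the bad events must be exhibited as preimages under that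
    sequence.\<close>
  have A_sets: "A k \<in> sets (vimage_algebra (space M) \<Xi> (Pi\<^sub>M {1..} (\<lambda>_. borel)))" for k
  proof -
    let ?P = "Pi\<^sub>M {1::nat..} (\<lambda>_. borel :: real measure)"
    let ?E = "{x \<in> space ?P. \<exists>n. L < (\<Sum>i\<in>{k<..k + n}. ln (\<bar>1 + q - \<sigma> * x i\<bar> + \<epsilon>) + \<rho>)}"
    have [measurable]: "(\<lambda>x. x i) \<in> borel_measurable ?P" if "i \<in> {k<..k + n}" for i n
      using that by (intro measurable_component_singleton) auto
    have "?E \<in> sets ?P" by measurable
    then have "\<Xi> -` ?E \<inter> space M \<in> sets (vimage_algebra (space M) \<Xi> ?P)"
      by (rule in_vimage_algebra)
    also have "\<Xi> -` ?E \<inter> space M = A k"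
      by (auto simp: A_def \<Xi>_def y_def space_PiM)
    finally show ?thesis .
  qed
  \<comment> \<open>Radius of the linear regime: below it
    \<open>C * \<bar>x\<bar> powr \<kappa> \<le> \<epsilon>\<close>, so the remainder is at most
    \<open>\<epsilon> * \<bar>x\<bar>\<close>.\<close>
  define \<theta> where "\<theta> = min u ((\<epsilon> / C) powr (1 / \<kappa>))"
  have \<theta>: "0 < \<theta>" "\<theta> \<le> u" using pos \<epsilon> by (auto simp: \<theta>_def)
  have small: "C * \<bar>x\<bar> powr \<kappa> \<le> \<epsilon>" if "\<bar>x\<bar> < \<theta>" for x
  proof -
    have "\<bar>x\<bar> powr \<kappa> \<le> ((\<epsilon> / C) powr (1 / \<kappa>)) powr \<kappa>"
      using that pos by (intro powr_mono2) (auto simp: \<theta>_def)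
    also have "\<dots> = \<epsilon> / C" using pos \<epsilon> by (simp add: powr_powr)
    finally show ?thesis using pos by (simp add: field_simps)
  qed
  have contraction: "\<bar>f v + \<sigma> * \<xi> i \<omega> * (v - K) - K\<bar> \<le> \<bar>v - K\<bar> * exp (y i \<omega>)"
    if v: "\<bar>v - K\<bar> < \<theta>" for v i \<omega>
  proof -
    let ?w = "1 + q - \<sigma> * \<xi> i \<omega>"
    have "f v = K - (1 + q) * (v - K) + \<phi> (v - K)" using v \<theta> by (intro expansion) auto
    then have "f v + \<sigma> * \<xi> i \<omega> * (v - K) - K = - (?w * (v - K)) + \<phi> (v - K)"
      by (simp add: algebra_simps)
    then have "\<bar>f v + \<sigma> * \<xi> i \<omega> * (v - K) - K\<bar> \<le> \<bar>?w\<bar> * \<bar>v - K\<bar> + \<bar>\<phi> (v - K)\<bar>"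
      by (metis abs_minus_cancel abs_mult abs_triangle_ineq)
    also have "\<bar>\<phi> (v - K)\<bar> \<le> C * \<bar>v - K\<bar> powr (1 + \<kappa>)"
      using v \<theta> by (intro phi_bound) auto
    also have "\<dots> = \<bar>v - K\<bar> * (C * \<bar>v - K\<bar> powr \<kappa>)" by (simp add: powr_add)
    also have "\<dots> \<le> \<bar>v - K\<bar> * \<epsilon>" by (intro mult_left_mono small v) auto
    also have "\<bar>?w\<bar> * \<bar>v - K\<bar> + \<bar>v - K\<bar> * \<epsilon> = \<bar>v - K\<bar> * exp (y i \<omega>)"
      using \<epsilon> by (simp add: y_def algebra_simps add_pos_nonneg)
    finally show ?thesis by simp
  qed
  \<comment> \<open>The factor \<open>exp (- L)\<close> compensates the largest possible growth
    outside the bad events; the factor 1/2 makes the inequality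
    \<open>\<delta> * exp L < \<theta>\<close> strict.\<close>
  define \<delta>\<^sub>0 where "\<delta>\<^sub>0 = \<theta> / 2 * exp (- L)"
  show thesis
  proof (rule that[of \<rho> \<theta> \<delta>\<^sub>0])
    show "0 < \<rho>" "0 < \<theta>" "0 < \<delta>\<^sub>0" using \<rho> \<theta> by (auto simp: \<delta>\<^sub>0_def)
    fix \<delta> assume "\<delta> \<le> \<delta>\<^sub>0"
    then have "\<delta> * exp L \<le> \<delta>\<^sub>0 * exp L" by simp
    also have "\<dots> = \<theta> / 2" by (simp add: \<delta>\<^sub>0_def mult.assoc flip: exp_add)
    finally have \<delta>: "\<delta> * exp L < \<theta>" using \<theta> by simp
    show "property_P M f K \<sigma> \<xi> \<gamma> \<rho> \<theta> \<delta>"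
      unfolding property_P_def
    proof (intro allI impI)
      fix \<tau> z
      assume moment: "as_finite_moment M \<tau>" and ind: "moment_indep_of_noise M \<xi> \<tau>"
        and sol: "noisy_solution_from M f K \<sigma> \<xi> \<tau> z"
        and start: "AE \<omega> in M. z (the_enat (\<tau> \<omega>)) \<omega> \<in> {K - \<delta><..<K + \<delta>}"
      have [measurable]: "\<tau> \<in> measurable M (count_space UNIV)"
        using moment by (simp add: as_finite_moment_def)
      let ?rec = "\<lambda>\<omega>. \<forall>n. \<tau> \<omega> \<le> enat n \<longrightarrow> (\<forall>m. \<tau> \<omega> \<le> enat m \<and> m \<le> n \<longrightarrow> 0 \<le> z m \<omega>) \<longrightarrow>
        z (Suc n) \<omega> = f (z n \<omega>) + \<sigma> * \<xi> (Suc n) \<omega> * (z n \<omega> - K)"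
      \<comment> \<open>All almost sure properties are gathered outside one null set, since the
        decay has to hold at every point of the good set.\<close>
      have "AE \<omega> in M. \<tau> \<omega> \<noteq> \<infinity> \<and> ?rec \<omega> \<and> z (the_enat (\<tau> \<omega>)) \<omega> \<in> {K - \<delta><..<K + \<delta>}"
        using moment sol start unfolding as_finite_moment_def noisy_solution_from_def by auto
      then obtain N where N: "N \<in> null_sets M" and good: "\<And>\<omega>. \<omega> \<in> space M - N \<Longrightarrow>
          \<tau> \<omega> \<noteq> \<infinity> \<and> ?rec \<omega> \<and> z (the_enat (\<tau> \<omega>)) \<omega> \<in> {K - \<delta><..<K + \<delta>}"
        by (rule AE_E3) blast
      define T where "T = (\<Union>k. {\<omega> \<in> space M. \<tau> \<omega> = enat k} \<inter> A k)"
      have ind': "indep_set (sets (vimage_algebra (space M) \<tau> (count_space UNIV)))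
          (sets (vimage_algebra (space M) \<Xi> (Pi\<^sub>M {1..} (\<lambda>_. borel))))"
        using ind by (simp add: moment_indep_of_noise_def \<Xi>_def[abs_def])
      have T_prob: "prob T \<le> \<gamma> / 2"
        unfolding T_def by (intro prob_at_independent_moment_le[OF _ ind'] A_sets A_prob) auto
      have "A k \<in> events" for k using indep_setD_ev2[OF ind'] A_sets by blast
      then have T_meas[measurable]: "T \<in> events" unfolding T_def by auto
      define G where "G = space M - (N \<union> T)"
      have [measurable]: "N \<in> events" using N by auto
      have G_meas[measurable]: "G \<in> events" by (simp add: G_def)
      have "prob (N \<union> T) \<le> prob N + prob T" by (rule measure_Un_le) auto
      also have "prob N = 0" using N by (simp add: measure_eq_0_null_sets)
      finally have G_prob: "1 - \<gamma> < prob G"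
        using T_prob pos by (simp add: G_def prob_compl)
      have decay: "\<bar>z (k + n) \<omega> - K\<bar> \<le> \<theta> * exp (- \<rho> * real n)"
        if \<omega>: "\<omega> \<in> G" and k: "\<tau> \<omega> = enat k" for \<omega> k n
      proof -
        have rec: "?rec \<omega>" and init: "\<bar>z k \<omega> - K\<bar> \<le> \<delta>"
          using good[of \<omega>] \<omega> k by (auto simp: G_def)
        have "\<bar>z (k + n) \<omega> - K\<bar> \<le> \<delta> * exp L * exp (- \<rho> * real n)"
        proof (rule random_multiplier_decay[where y = "\<lambda>i. y i \<omega>" and \<theta> = \<theta>])
          fix n assume n: "k \<le> n" and near: "\<forall>m\<in>{k..n}. \<bar>z m \<omega> - K\<bar> < \<theta>"
          \<comment> \<open>The recursion is available only while the path is nonnegative; staying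
            within \<theta> of \<open>K\<close> ensures this.\<close>
          have "0 \<le> z m \<omega>" if "m \<in> {k..n}" for m
          proof -
            have "z m \<omega> \<in> {K - u<..<K + u}" using near \<theta> that by fastforce
            then show ?thesis using domain by auto
          qed
          then have "z (Suc n) \<omega> = f (z n \<omega>) + \<sigma> * \<xi> (Suc n) \<omega> * (z n \<omega> - K)"
            using rec k n by auto
          then show "\<bar>z (Suc n) \<omega> - K\<bar> \<le> \<bar>z n \<omega> - K\<bar> * exp (y (Suc n) \<omega>)"
            using contraction[of "z n \<omega>" "Suc n" \<omega>] near n by simp
        next
          fix n show "(\<Sum>i\<in>{k<..k + n}. y i \<omega> + \<rho>) \<le> L"
            using \<omega> k by (auto simp: G_def T_def A_def not_less)
        qed (use init \<delta> \<rho> in auto)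
        also have "\<dots> \<le> \<theta> * exp (- \<rho> * real n)" using \<delta> by simp
        finally show ?thesis .
      qed
      have finite_\<tau>: "\<exists>k. \<tau> \<omega> = enat k" if "\<omega> \<in> G" for \<omega>
        using that good[of \<omega>] by (auto simp: G_def)
      have "decay_from_moment M K \<gamma> \<rho> \<theta> \<tau> z"
        unfolding decay_from_moment_def
      proof (intro bexI[of _ G] conjI ballI allI impI)
        fix \<omega> assume \<omega>: "\<omega> \<in> G"
        then obtain k where k: "\<tau> \<omega> = enat k" using finite_\<tau> by blast
        show "\<bar>z m \<omega> - K\<bar> \<le> \<theta> * exp (- \<rho> * (real m - real (the_enat (\<tau> \<omega>))))"
          if "\<tau> \<omega> \<le> enat m" for m
          using decay[OF \<omega> k, of "m - k"] that k by (simp add: of_nat_diff)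
        have "(\<lambda>n. exp (- \<rho>) ^ n) \<longlonglongrightarrow> 0" using \<rho> by (intro LIMSEQ_realpow_zero) auto
        then have "(\<lambda>n. \<theta> * exp (- \<rho> * real n)) \<longlonglongrightarrow> 0"
          by (intro tendsto_mult_right_zero) (simp add: mult.commute flip: exp_of_nat_mult)
        moreover have "norm (z (n + k) \<omega> - K) \<le> \<theta> * exp (- \<rho> * real n)" for n
          using decay[OF \<omega> k, of n] unfolding real_norm_def add.commute[of k n] .
        ultimately have "(\<lambda>n. z (n + k) \<omega> - K) \<longlonglongrightarrow> 0"
          by (rule Lim_null_comparison[OF always_eventually, OF allI, rotated])
        then have "(\<lambda>n. z (n + k) \<omega>) \<longlonglongrightarrow> K" by (rule LIM_zero_cancel)
        then show "(\<lambda>m. z m \<omega>) \<longlonglongrightarrow> K" by (rule LIMSEQ_offset)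
      qed (use G_prob in auto)
      moreover have "decay_from_nonrandom M K \<gamma> \<rho> \<theta> z"
      proof -
        \<comment> \<open>These sets increase to \<open>G\<close>, so by continuity of the measure
          one of them still has probability above \<open>1 - \<gamma>\<close>. On it the random
          moment is bounded by a constant.\<close>
        define H where "H n = {\<omega> \<in> G. \<tau> \<omega> \<le> enat n}" for n
        have G_space: "G \<subseteq> space M" by (auto simp: G_def)
        have "H n = G \<inter> {\<omega> \<in> space M. \<tau> \<omega> \<le> enat n}" for n using G_space by (auto simp: H_def)
        then have H_meas: "H n \<in> events" for n by simp
        have inc: "incseq H" unfolding incseq_def H_def using order_trans by fastforce
        have "(\<Union>n. H n) = G" using finite_\<tau> by (auto simp: H_def) (metis order_refl)
        with H_meas inc have "(\<lambda>n. prob (H n)) \<longlonglongrightarrow> prob G"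
          by (metis finite_Lim_measure_incseq image_subset_iff)
        then have "\<forall>\<^sub>F n in sequentially. 1 - \<gamma> < prob (H n)"
          using G_prob by (rule order_tendstoD)
        then obtain n where n: "1 - \<gamma> < prob (H n)" by (auto simp: eventually_sequentially)
        show ?thesis
          unfolding decay_from_nonrandom_def
        \<comment> \<open>The successor meets the requirement \<open>1 \<le> n\<^sub>0\<close>.
          Counting time from a later moment than \<tau> only weakens the decay.\<close>
        proof (intro bexI[of _ "H n"] exI[of _ "Suc n"] conjI ballI allI impI)
          fix \<omega> m assume \<omega>: "\<omega> \<in> H n" and m: "Suc n \<le> m"
          then obtain k where k: "\<tau> \<omega> = enat k" using finite_\<tau> by (auto simp: H_def)
          have kn: "k \<le> n" using \<omega> k by (simp add: H_def)
          have "\<bar>z m \<omega> - K\<bar> \<le> \<theta> * exp (- \<rho> * real (m - k))"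
            using decay[of \<omega> k "m - k"] \<omega> k kn m by (simp add: H_def)
          also have "\<dots> \<le> \<theta> * exp (- \<rho> * (real m - real (Suc n)))"
            using kn m \<rho> \<theta> by (intro mult_left_mono) (auto simp: of_nat_diff)
          finally show "\<bar>z m \<omega> - K\<bar> \<le> \<theta> * exp (- \<rho> * (real m - real (Suc n)))" .
        qed (use n H_meas in auto)
      qed
      ultimately show "decay_from_moment M K \<gamma> \<rho> \<theta> \<tau> z \<and> decay_from_nonrandom M K \<gamma> \<rho> \<theta> z" ..
    qed
  qed
qed

subsection \<open>Directed walk control\<close>

text \<open>With \<open>LEAST\<close> in place of the infimum, measurability can be derived
  automatically and membership in \<open>S\<close> at the entry moment follows from
  \<open>LeastI_ex\<close>.\<close>

lemma entry_moment_Least: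
  "entry_moment S z \<omega> = (if \<exists>n. z n \<omega> \<in> S then enat (LEAST n. z n \<omega> \<in> S) else \<infinity>)"
proof (cases "\<exists>n. z n \<omega> \<in> S")
  case True
  have "Inf {enat n |n. z n \<omega> \<in> S} = enat (LEAST n. z n \<omega> \<in> S)"
  proof (rule Inf_eqI)
    show "enat (LEAST n. z n \<omega> \<in> S) \<le> i" if "i \<in> {enat n |n. z n \<omega> \<in> S}" for i
      using that by (auto intro: Least_le)
    show "y \<le> enat (LEAST n. z n \<omega> \<in> S)" if "\<And>i. i \<in> {enat n |n. z n \<omega> \<in> S} \<Longrightarrow> y \<le> i" for y
      using True by (intro that) (auto intro: LeastI)
  qed
  then show ?thesis using True by (simp add: entry_moment_def)
next
  case False
  then show ?thesis by (simp add: entry_moment_def top_enat_def)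
qed

lemma measurable_entry_moment:
  assumes [measurable]: "\<And>n. z n \<in> borel_measurable M" "S \<in> sets borel"
  shows "entry_moment S z \<in> measurable M (count_space UNIV)"
  unfolding entry_moment_Least[abs_def] by measurable

text \<open>Agreement is demanded only up to the first entry, because the control equation says
  nothing about the solution afterwards.\<close>

lemma entry_moment_cong:
  assumes "\<And>n. (\<And>m. m < n \<Longrightarrow> z m \<omega> \<notin> S) \<Longrightarrow> z n \<omega> = z' n \<omega>'"
  shows "entry_moment S z \<omega> = entry_moment S z' \<omega>'"
proof (cases "\<exists>n. z n \<omega> \<in> S")
  case True
  define k where "k = (LEAST n. z n \<omega> \<in> S)"
  have before: "z m \<omega> \<notin> S" if "m < k" for m using that not_less_Least unfolding k_def by blast
  have eq: "z m \<omega> = z' m \<omega>'" if "m \<le> k" for m using that before by (intro assms) auto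
  have "z k \<omega> \<in> S" unfolding k_def using True by (rule LeastI_ex)
  then have in_S: "z' k \<omega>' \<in> S" using eq by simp
  have "(LEAST n. z' n \<omega>' \<in> S) = k"
  proof (rule Least_equality, fact in_S)
    show "k \<le> n" if "z' n \<omega>' \<in> S" for n
      using that before[of n] eq[of n] by (cases "n < k") auto
  qed
  then show ?thesis using True in_S by (auto simp: entry_moment_Least k_def)
next
  case False
  then have "z n \<omega> = z' n \<omega>'" for n using assms by blast
  then show ?thesis using False by (simp add: entry_moment_Least)
qed

text \<open>Preimages under the two moments differ by null sets, which no probability in the product
  formula detects. It is needed because the entry moment equals a function of the control noises
  only almost surely.\<close>

lemma moment_indep_of_noise_cong_AE:
  assumes "prob_space M" and indep: "moment_indep_of_noise M \<xi> \<tau>'"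
    and [measurable]: "\<tau> \<in> measurable M (count_space UNIV)" "\<tau>' \<in> measurable M (count_space UNIV)"
    and eq: "AE \<omega> in M. \<tau> \<omega> = \<tau>' \<omega>"
  shows "moment_indep_of_noise M \<xi> \<tau>"
proof -
  interpret prob_space M by fact
  let ?V = "\<lambda>\<tau>. sets (vimage_algebra (space M) \<tau> (count_space UNIV))"
  let ?X = "sets (vimage_algebra (space M) (\<lambda>\<omega>. \<lambda>i\<in>{1..}. \<xi> i \<omega>) (Pi\<^sub>M {1..} (\<lambda>_. borel)))"
  have ind: "?V \<tau>' \<subseteq> events" "?X \<subseteq> events"
    "\<And>a b. a \<in> ?V \<tau>' \<Longrightarrow> b \<in> ?X \<Longrightarrow> prob (a \<inter> b) = prob a * prob b"
    using indep unfolding moment_indep_of_noise_def indep_sets2_eq by auto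
  have V: "?V \<tau> = {\<tau> -` S \<inter> space M | S. True}" for \<tau> :: "'a \<Rightarrow> enat"
    by (subst sets_vimage_algebra2) auto
  show ?thesis
    unfolding moment_indep_of_noise_def indep_sets2_eq
  proof (intro conjI ballI ind(2))
    show "?V \<tau> \<subseteq> events" unfolding V by (auto intro: measurable_sets)
    fix a b assume "a \<in> ?V \<tau>" and b: "b \<in> ?X"
    then obtain S where a: "a = \<tau> -` S \<inter> space M" unfolding V by auto
    define a' where "a' = \<tau>' -` S \<inter> space M"
    have meas: "a \<in> events" "a' \<in> events" "b \<in> events"
      using b ind(2) by (auto simp: a a'_def intro: measurable_sets)
    have "prob a = prob a'" "prob (a \<inter> b) = prob (a' \<inter> b)"
      using eq meas by (auto intro!: finite_measure_eq_AE simp: a a'_def)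
    moreover have "a' \<in> ?V \<tau>'" unfolding V by (auto simp: a'_def)
    ultimately show "prob (a \<inter> b) = prob a * prob b" using ind(3)[OF _ b] by simp
  qed
qed

section \<open>Independence of the noise blocks\<close>

lemma noises_indep_first:
  assumes "prob_space M" "mutually_independent_noises M \<xi> \<zeta> chi"
  shows "prob_space.indep_vars M (\<lambda>_. borel) \<xi> {1..}"
proof -
  interpret prob_space M by fact
  let ?X = "\<lambda>(i, n). ([\<xi>, \<zeta>, chi] ! i) n"
  have "indep_vars (\<lambda>_. borel) ?X (Pair 0 ` {1..})"
    using assms(2) unfolding mutually_independent_noises_def
    by (rule indep_vars_subset) auto
  then have "indep_vars (\<lambda>_. borel) (\<lambda>n. ?X (0, n)) {1..}"
    by (rule indep_vars_reindex) (auto simp: inj_on_def)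
  then show ?thesis by simp
qed

text \<open>Row 0 of the family is \<xi>, rows 1 and 2 are \<zeta> and \<open>chi\<close>. Disjoint
  blocks of indices generate independent sigma-algebras, and independence passes to the smaller
  sigma-algebras generated by functions of each block.\<close>

lemma moment_indep_of_first_noise:
  fixes M :: "'a measure"
  assumes "prob_space M" and noises: "mutually_independent_noises M \<xi> \<zeta> chi"
    and T: "T \<in> measurable (Pi\<^sub>M ({1, 2} \<times> {1..}) (\<lambda>_. borel)) (count_space UNIV)"
  shows "moment_indep_of_noise M \<xi>
    (\<lambda>\<omega>. T (\<lambda>(i, n)\<in>{1, 2} \<times> {1..}. ([\<xi>, \<zeta>, chi] ! i) n \<omega>))"
proof -
  interpret prob_space M by fact
  let ?X = "\<lambda>(i, n). ([\<xi>, \<zeta>, chi] ! i) n"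
  let ?A = "{1, 2} \<times> {1..} :: (nat \<times> nat) set" and ?B = "{0} \<times> {1..} :: (nat \<times> nat) set"
  let ?PA = "Pi\<^sub>M ?A (\<lambda>_. borel :: real measure)" and ?PB = "Pi\<^sub>M ?B (\<lambda>_. borel :: real measure)"
  let ?P = "Pi\<^sub>M {1..} (\<lambda>_::nat. borel :: real measure)"
  define Q where "Q \<omega> = (\<lambda>p\<in>?A. ?X p \<omega>)" for \<omega>
  define R where "R \<omega> = (\<lambda>p\<in>?B. ?X p \<omega>)" for \<omega>
  \<comment> \<open>Drops the constant first coordinate, so that row 0 becomes the sequence
    appearing in \<open>moment_indep_of_noise\<close>.\<close>
  define \<pi> where "\<pi> x = (\<lambda>n\<in>{1..}. x (0::nat, n::nat) :: real)" for x
  have "indep_var ?PA Q ?PB R"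
    using noises unfolding mutually_independent_noises_def Q_def[abs_def] R_def[abs_def]
    by (rule indep_var_restrict) auto
  then have ind: "indep_set (sets (vimage_algebra (space M) Q ?PA)) (sets (vimage_algebra (space M) R ?PB))"
    by (simp add: indep_var_eq sets_vimage_algebra)
  have T_Q: "(\<lambda>\<omega>. T (\<lambda>(i, n)\<in>?A. ([\<xi>, \<zeta>, chi] ! i) n \<omega>)) = (\<lambda>\<omega>. T (Q \<omega>))"
    by (auto simp: fun_eq_iff Q_def intro!: arg_cong[where f = T])
  have \<pi>_R: "(\<lambda>\<omega>. \<lambda>i\<in>{1..}. \<xi> i \<omega>) = (\<lambda>\<omega>. \<pi> (R \<omega>))"
    by (auto simp: fun_eq_iff \<pi>_def R_def)
  have Q: "Q \<in> measurable (vimage_algebra (space M) Q ?PA) ?PA"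
    by (intro measurable_vimage_algebra1) (auto simp: Q_def space_PiM)
  have R: "R \<in> measurable (vimage_algebra (space M) R ?PB) ?PB"
    by (intro measurable_vimage_algebra1) (auto simp: R_def space_PiM)
  have \<pi>: "\<pi> \<in> measurable ?PB ?P"
    unfolding \<pi>_def by (intro measurable_restrict measurable_component_singleton) auto
  have "sets (vimage_algebra (space M) (\<lambda>\<omega>. T (Q \<omega>)) (count_space UNIV))
      \<subseteq> sets (vimage_algebra (space M) Q ?PA)"
    using measurable_compose[OF Q T]
    by (intro sets_image_in_sets) auto
  moreover have "sets (vimage_algebra (space M) (\<lambda>\<omega>. \<pi> (R \<omega>)) ?P)
      \<subseteq> sets (vimage_algebra (space M) R ?PB)"
    using measurable_compose[OF R \<pi>]
    by (intro sets_image_in_sets) auto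
  ultimately show ?thesis
    using ind unfolding moment_indep_of_noise_def T_Q \<pi>_R indep_sets2_eq by blast
qed

section \<open>Passage of the walk through the levels\<close>

lemma ex_last_level:
  fixes n k :: nat
  assumes "n \<le> k" "P n" "\<not> P k"
  shows "\<exists>j. n \<le> j \<and> j < k \<and> P j \<and> \<not> P (Suc j)"
proof (rule ccontr)
  assume "\<not> ?thesis"
  then have "P (Suc j)" if "n \<le> j" "j < k" "P j" for j using that by blast
  with assms(1,2) have "P k" by (rule dec_induct)
  then show False using assms(3) by contradiction
qed

text \<open>Here \<open>y\<close> is \<open>f z - K\<close>, \<open>v\<close> is
  \<open>\<bar>z - K\<bar>\<close> and \<open>r\<close> is the radius of the current level.
  Subtracting \<open>(1 + q) * r\<close> from \<open>\<bar>y\<bar>\<close> leaves at most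
  \<open>5/8 * r\<close> in absolute value, each of the two noises adds at most
  \<open>r / 16\<close>, and the total \<open>3/4 * r\<close> is below
  \<open>7/8 * r \<le> r * (1 - s)\<close>.\<close>

lemma dwc_step_contracts:
  fixes q r s v y h c :: real
  assumes q: "0 < q" and r: "0 < r" and s: "s = 1 / (8 * (1 + q))"
    and v: "r * (1 - s) \<le> v" "v \<le> r"
    and y: "(1 / 2 + q) * v \<le> \<bar>y\<bar>" "\<bar>y\<bar> \<le> (3 / 2 + q) * v"
    and c: "\<bar>c\<bar> \<le> 1" and h: "\<bar>h\<bar> \<le> 1" and l: "0 < l" "l \<le> r / 16"
  shows "\<bar>y - (1 + q) * r * (1 + 1 / (16 * (1 + q)) * c) * (y / \<bar>y\<bar>) + l * h\<bar> < r * (1 - s)"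
proof -
  \<comment> \<open>The choice of \<open>s\<close> limits the loss from \<open>v\<close> being as
    small as \<open>r * (1 - s)\<close>: together with \<open>r / 2\<close> it accounts for the
    \<open>5/8 * r\<close> below.\<close>
  have s8: "0 < s" "s \<le> 1 / 8" "s * (1 / 2 + q) \<le> 1 / 8"
    using q by (auto simp: s field_simps)
  have "0 < r * (1 - s)" using r s8 by simp
  then have "0 < v" using v by simp
  then have "0 < (1 / 2 + q) * v" using q by simp
  then have y0: "y \<noteq> 0" using y by auto
  define e where "e = y / \<bar>y\<bar>"
  have e: "\<bar>e\<bar> = 1" "y = \<bar>y\<bar> * e" using y0 by (auto simp: e_def)
  have "(3 / 2 + q) * v \<le> (3 / 2 + q) * r" using v q by (intro mult_left_mono) auto
  then have up: "\<bar>y\<bar> - (1 + q) * r \<le> r / 2" using y by (simp add: algebra_simps)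
  have "(1 / 2 + q) * (r * (1 - s)) \<le> (1 / 2 + q) * v" using v q by (intro mult_left_mono) auto
  then have "(1 / 2 + q) * (r * (1 - s)) \<le> \<bar>y\<bar>" using y by simp
  moreover have "(1 / 2 + q) * (r * (1 - s)) = (1 + q) * r - r / 2 - r * (s * (1 / 2 + q))"
    by (simp add: field_simps)
  moreover have "r * (s * (1 / 2 + q)) \<le> r * (1 / 8)" using r s8 by (intro mult_left_mono) auto
  ultimately have low: "- (5 / 8 * r) \<le> \<bar>y\<bar> - (1 + q) * r" by simp
  have "\<bar>\<bar>y\<bar> - (1 + q) * r\<bar> \<le> 5 / 8 * r"
    by (rule abs_leI) (use up low r in linarith)+
  then have "\<bar>(\<bar>y\<bar> - (1 + q) * r) * e\<bar> \<le> 5 / 8 * r" by (simp add: abs_mult e(1))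
  moreover have "\<bar>r / 16 * c * e\<bar> \<le> r / 16 * 1 * 1"
    unfolding abs_mult using r c e by (intro mult_mono) auto
  moreover have "\<bar>l * h\<bar> \<le> r / 16 * 1" unfolding abs_mult using l h r by (intro mult_mono) auto
  moreover have "y - (1 + q) * r * (1 + 1 / (16 * (1 + q)) * c) * e + l * h
      = (\<bar>y\<bar> - (1 + q) * r) * e - r / 16 * c * e + l * h"
  proof -
    have "(1 + q) * (1 / (16 * (1 + q))) = 1 / 16" using q by simp
    then have *: "(1 + q) * r * (1 + 1 / (16 * (1 + q)) * c) = (1 + q) * r + r / 16 * c"
      using q by (simp add: field_simps)
    show ?thesis unfolding * by (subst e(2)) (simp add: algebra_simps)
  qed
  moreover have "\<bar>A - B + D\<bar> \<le> a + b + d" if "\<bar>A\<bar> \<le> a" "\<bar>B\<bar> \<le> b" "\<bar>D\<bar> \<le> d" for A B D a b d :: real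
    using that by linarith
  ultimately have "\<bar>y - (1 + q) * r * (1 + 1 / (16 * (1 + q)) * c) * e + l * h\<bar>
      \<le> 5 / 8 * r + r / 16 * 1 * 1 + r / 16 * 1" by presburger
  also have "\<dots> < r * (7 / 8)" using r by simp
  also have "\<dots> \<le> r * (1 - s)" using r s8 by (intro mult_left_mono) auto
  finally show ?thesis by (simp add: e_def)
qed

text \<open>Before entry each step gains at least one level, so the target is reached within
  \<open>k\<close> steps. Up to that time the path is almost surely determined by \<zeta>,
  \<open>chi\<close> and the nonrandom start, which gives independence of \<xi>.\<close>

lemma dwc_entry_moment:
  fixes M :: "'a measure" and K u \<delta> a l l\<^sub>c x\<^sub>0 :: real and \<alpha> :: "nat \<Rightarrow> real" and k :: nat
  defines "J \<equiv> dwc_interval K u \<delta> a k"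
  assumes "prob_space M"
    and f_cont: "continuous_on {0..} f"
    and domain: "J 0 \<subseteq> {0..}"
    and nested: "\<And>j. j < k \<Longrightarrow> J (Suc j) \<subseteq> J j"
    and contract: "\<And>j v c h. \<lbrakk>j < k; v \<in> J j - J (Suc j); \<bar>c\<bar> \<le> 1; \<bar>h\<bar> \<le> 1\<rbrakk> \<Longrightarrow>
      f v - \<alpha> j * (1 + l\<^sub>c * c) * ((f v - K) / \<bar>f v - K\<bar>) + l * h \<in> J (Suc j)"
    and noises: "noise_sequence M \<zeta>" "noise_sequence M chi" "mutually_independent_noises M \<xi> \<zeta> chi"
    and x\<^sub>0: "x\<^sub>0 \<in> J 0"
    and sol: "dwc_solution M f K u \<delta> a k l l\<^sub>c \<alpha> \<zeta> chi x\<^sub>0 z"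
  shows "as_finite_moment M (entry_moment (J k) z)"
    and "moment_indep_of_noise M \<xi> (entry_moment (J k) z)"
proof -
  interpret prob_space M by fact
  have J_meas[measurable]: "J j \<in> sets borel" for j by (simp add: J_def dwc_interval_def)
  have anti: "J j \<subseteq> J i" if "i \<le> j" "j \<le> k" for i j
    using that
  proof (induction j rule: dec_induct)
    case (step n)
    then show ?case using nested[of n] by simp
  qed simp
  have z_meas[measurable]: "z n \<in> borel_measurable M" for n using sol by (simp add: dwc_solution_def)
  have \<zeta>_meas: "\<zeta> n \<in> borel_measurable M" and chi_meas: "chi n \<in> borel_measurable M" if "1 \<le> n" for n
    using noises that by (auto simp: noise_sequence_def)
  define F where "F j v c h = f v - \<alpha> j * (1 + l\<^sub>c * c) * ((f v - K) / \<bar>f v - K\<bar>) + l * h" for j v c h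
  \<comment> \<open>Continuity of \<open>f\<close> is known on \<open>{0..}\<close> only; the
    extension by 0 is Borel on the whole line.\<close>
  define f\<^sub>0 where "f\<^sub>0 v = indicator {0..} v *\<^sub>R f v" for v
  have [measurable]: "f\<^sub>0 \<in> borel_measurable borel"
    unfolding f\<^sub>0_def using f_cont by (intro borel_measurable_continuous_on_indicator) auto
  \<comment> \<open>One globally defined Borel map glues the step maps of all levels. The rings are
    disjoint, so at most one summand survives; off the rings the value is 0.\<close>
  define G where "G v c h = (\<Sum>j<k. indicator (J j - J (Suc j)) v *
    (f\<^sub>0 v - \<alpha> j * (1 + l\<^sub>c * c) * ((f\<^sub>0 v - K) / \<bar>f\<^sub>0 v - K\<bar>) + l * h))" for v c h :: real
  have G_level: "G v c h = F j v c h" if j: "j < k" "v \<in> J j - J (Suc j)" for j v c h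
  proof -
    have "v \<in> J 0" using anti[of 0 j] j by auto
    then have "f\<^sub>0 v = f v" using domain by (auto simp: f\<^sub>0_def)
    moreover have "v \<notin> J i - J (Suc i)" if "i < k" "i \<noteq> j" for i
      using anti[of "Suc i" j] anti[of "Suc j" i] that j by (cases "i < j") auto
    ultimately have "G v c h = (\<Sum>i<k. if i = j then F j v c h else 0)"
      unfolding G_def F_def using j by (intro sum.cong) (auto simp: indicator_def)
    also have "\<dots> = F j v c h" using j by simp
    finally show ?thesis .
  qed
  \<comment> \<open>A model path on the sequence space of the control noises: coordinates
    \<open>(2, _)\<close> play the part of \<open>chi\<close> and \<open>(1, _)\<close> that of
    \<zeta>.\<close>
  define Z where "Z p = rec_nat x\<^sub>0 (\<lambda>n v. G v (p (2, Suc n)) (p (1, Suc n)))"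
    for p :: "nat \<times> nat \<Rightarrow> real"
  have Z_simps: "Z p 0 = x\<^sub>0" "Z p (Suc n) = G (Z p n) (p (2, Suc n)) (p (1, Suc n))" for p n
    by (simp_all add: Z_def)
  let ?I = "{1, 2} \<times> {1..} :: (nat \<times> nat) set"
  let ?P = "Pi\<^sub>M ?I (\<lambda>_. borel :: real measure)"
  have Z_meas: "(\<lambda>p. Z p n) \<in> borel_measurable ?P" for n
  proof (induction n)
    case (Suc n)
    note [measurable] = Suc
    have [measurable]: "(\<lambda>p. p (1, Suc n)) \<in> borel_measurable ?P" "(\<lambda>p. p (2, Suc n)) \<in> borel_measurable ?P"
      by (intro measurable_component_singleton; simp)+
    show ?case unfolding Z_simps G_def by measurable
  qed (simp add: Z_simps)
  define p where "p \<omega> = (\<lambda>(i, n)\<in>?I. ([\<xi>, \<zeta>, chi] ! i) n \<omega>)" for \<omega>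
  define T where "T = entry_moment (J k) (\<lambda>n p. Z p n)"
  have T_meas: "T \<in> measurable ?P (count_space UNIV)"
    unfolding T_def using Z_meas by (intro measurable_entry_moment) auto
  have p_meas: "p \<in> measurable M ?P"
    unfolding p_def by (intro measurable_restrict) (use \<zeta>_meas chi_meas in \<open>auto simp: nth_Cons'\<close>)
  have T_indep: "moment_indep_of_noise M \<xi> (\<lambda>\<omega>. T (p \<omega>))"
    unfolding p_def by (rule moment_indep_of_first_noise[OF assms(2) noises(3) T_meas])
  have entry_meas: "entry_moment (J k) z \<in> measurable M (count_space UNIV)"
    by (intro measurable_entry_moment) auto
  have "AE \<omega> in M. z 0 \<omega> = x\<^sub>0 \<and> (\<forall>n. (\<forall>m\<le>n. z m \<omega> \<notin> J k) \<longrightarrow>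
      (\<forall>j<k. z n \<omega> \<in> J j - J (Suc j) \<longrightarrow> z (Suc n) \<omega> = F j (z n \<omega>) (chi (Suc n) \<omega>) (\<zeta> (Suc n) \<omega>)))"
    using sol by (simp add: dwc_solution_def J_def F_def)
  moreover have "AE \<omega> in M. \<forall>n. \<bar>\<zeta> (Suc n) \<omega>\<bar> \<le> 1" "AE \<omega> in M. \<forall>n. \<bar>chi (Suc n) \<omega>\<bar> \<le> 1"
    using noises by (auto simp: noise_sequence_def AE_all_countable)
  ultimately have "AE \<omega> in M. entry_moment (J k) z \<omega> \<noteq> \<infinity> \<and> entry_moment (J k) z \<omega> = T (p \<omega>)"
  proof eventually_elim
    case (elim \<omega>)
    \<comment> \<open>Location and agreement with the model path are proved together, because
      \<open>G\<close> reproduces the equation only on the rings.\<close>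
    have path: "z n \<omega> \<in> J (min n k) \<and> z n \<omega> = Z (p \<omega>) n" if "\<And>m. m < n \<Longrightarrow> z m \<omega> \<notin> J k" for n
      using that
    proof (induction n)
      case 0
      then show ?case using elim x\<^sub>0 by (simp add: Z_simps)
    next
      case (Suc n)
      then have IH: "z n \<omega> \<in> J (min n k)" "z n \<omega> = Z (p \<omega>) n" and out: "\<forall>m\<le>n. z m \<omega> \<notin> J k"
        by (auto simp: less_Suc_eq_le)
      obtain j where j: "min n k \<le> j" "j < k" "z n \<omega> \<in> J j - J (Suc j)"
        using ex_last_level[of "min n k" k "\<lambda>j. z n \<omega> \<in> J j"] IH(1) out by auto
      let ?c = "chi (Suc n) \<omega>" and ?h = "\<zeta> (Suc n) \<omega>"
      have next_z: "z (Suc n) \<omega> = F j (z n \<omega>) ?c ?h" using elim out j by blast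
      also have "\<dots> \<in> J (Suc j)" unfolding F_def using elim j by (intro contract) auto
      also have "J (Suc j) \<subseteq> J (min (Suc n) k)" using j by (intro anti) auto
      finally have "z (Suc n) \<omega> \<in> J (min (Suc n) k)" .
      moreover have "p \<omega> (2, Suc n) = ?c" "p \<omega> (1, Suc n) = ?h" by (simp_all add: p_def)
      then have "Z (p \<omega>) (Suc n) = F j (z n \<omega>) ?c ?h"
        unfolding Z_simps IH(2)[symmetric] using j by (simp add: G_level)
      ultimately show ?case using next_z by simp
    qed
    have "\<exists>n. z n \<omega> \<in> J k"
    proof (rule ccontr)
      assume "\<not> ?thesis"
      then show False using path[of k] by auto
    qed
    then have "entry_moment (J k) z \<omega> \<noteq> \<infinity>" by (simp add: entry_moment_Least)
    moreover have "entry_moment (J k) z \<omega> = T (p \<omega>)"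
      unfolding T_def using path by (intro entry_moment_cong) blast
    ultimately show ?case ..
  qed
  then show "as_finite_moment M (entry_moment (J k) z)"
    and "moment_indep_of_noise M \<xi> (entry_moment (J k) z)"
    using entry_meas measurable_compose[OF p_meas T_meas]
    by (auto simp: as_finite_moment_def intro!: moment_indep_of_noise_cong_AE[OF assms(2) T_indep])
qed

section \<open>Choice of the walk parameters\<close>

theorem theorem3p2:
  fixes M :: "'a measure" and F :: "nat \<Rightarrow> 'a measure"
    and f \<phi> :: "real \<Rightarrow> real"
    and K u q C \<kappa> \<sigma> lam \<gamma> :: real
    and \<xi> \<zeta> chi :: "nat \<Rightarrow> 'a \<Rightarrow> real"
  assumes space: "complete_filtered_prob_space M F"
    and f_cont: "continuous_on {0..} f"
    and f_range: "f \<in> {0..} \<rightarrow> {0..}"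
    and K_pos: "0 < K"
    and K_fixed: "f K = K"
    and K_unique: "\<And>x. 0 < x \<Longrightarrow> f x = x \<Longrightarrow> x = K"
    and f_sides: "\<And>x. 0 \<le> x \<Longrightarrow> x \<noteq> K \<Longrightarrow> (x - K) * (f x - K) < 0"
    and consts_pos: "0 < u" "0 < q" "0 < C" "0 < \<kappa>"
    and interval_in_domain: "{K - u<..<K + u} \<subseteq> {0..}"
    and f_expansion: "\<And>x. x \<in> {K - u<..<K + u} \<Longrightarrow> f x = K - (1 + q) * (x - K) + \<phi> (x - K)"
    and phi_bound: "\<And>x. x \<in> {- u<..<u} \<Longrightarrow> \<bar>\<phi> x\<bar> \<le> C * \<bar>x\<bar> powr (1 + \<kappa>)"
    and noises: "noise_sequence M \<xi>" "noise_sequence M \<zeta>" "noise_sequence M chi"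
    and noises_indep: "mutually_independent_noises M \<xi> \<zeta> chi"
    and sigma_pos: "0 < \<sigma>"
    and lam_pos: "0 < lam"
    and log_mean: "\<And>n. 1 \<le> n \<Longrightarrow> has_log_expectation M (\<lambda>\<omega>. 1 + q - \<sigma> * \<xi> n \<omega>) (- lam)"
    and gamma: "0 < \<gamma>" "\<gamma> < 1"
    and small: "C * u powr \<kappa> < 1 / 2"
  shows "\<exists>\<rho> \<eta> \<delta>. 0 < \<rho> \<and> 0 < \<eta> \<and> 0 < \<delta> \<and> \<delta> < u \<and>
    property_P M f K \<sigma> \<xi> \<gamma> \<rho> \<eta> \<delta> \<and>
    (\<exists>a k l l\<^sub>c \<alpha>. dwc_parameters K u \<delta> a k l l\<^sub>c \<alpha> \<and>
      (\<forall>x\<^sub>0\<in>{K - u<..<K + u}. \<forall>z.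
         dwc_solution M f K u \<delta> a k l l\<^sub>c \<alpha> \<zeta> chi x\<^sub>0 z \<longrightarrow>
         as_finite_moment M (entry_moment {K - \<delta><..<K + \<delta>} z) \<and>
         moment_indep_of_noise M \<xi> (entry_moment {K - \<delta><..<K + \<delta>} z) \<and>
         (noisy_solution_from M f K \<sigma> \<xi> (entry_moment {K - \<delta><..<K + \<delta>} z) z \<longrightarrow>
            decay_from_moment M K \<gamma> \<rho> \<eta> (entry_moment {K - \<delta><..<K + \<delta>} z) z \<and>
            decay_from_nonrandom M K \<gamma> \<rho> \<eta> z)))"
proof -
  interpret prob_space M using space by (simp add: complete_filtered_prob_space_def)
  have M: "prob_space M" by unfold_locales
  obtain \<rho> \<eta> \<delta>\<^sub>0 where \<rho>: "0 < \<rho>" and \<eta>: "0 < \<eta>" and \<delta>\<^sub>0: "0 < \<delta>\<^sub>0"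
    and P: "\<And>\<delta>. \<delta> \<le> \<delta>\<^sub>0 \<Longrightarrow> property_P M f K \<sigma> \<xi> \<gamma> \<rho> \<eta> \<delta>"
    by (rule ex_property_P[OF M interval_in_domain f_expansion phi_bound consts_pos sigma_pos
          lam_pos gamma(1) noises(1) noises_indep_first[OF M noises_indep] log_mean]) auto
  define s where "s = 1 / (8 * (1 + q))"
  have s: "0 < s" "s < 1" using consts_pos by (auto simp: s_def field_simps)
  \<comment> \<open>With this ratio, the contraction of one step from radius \<open>r\<close> to
    \<open>r * (1 - s)\<close> is exactly the passage to the next level.\<close>
  define a where "a = 1 / (1 - s)"
  have a: "1 < a" using s by (simp add: a_def)
  obtain n where n: "(1 - s) ^ n < \<delta>\<^sub>0 / u"
    using real_arch_pow_inv[of "\<delta>\<^sub>0 / u" "1 - s"] \<delta>\<^sub>0 consts_pos s by auto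
  define k where "k = Suc n"
  \<comment> \<open>Placing \<delta> on the geometric scale makes the innermost interval obey the
    same formula as the others. \<open>k = Suc n\<close> ensures \<open>1 \<le> k\<close>.\<close>
  define \<delta> where "\<delta> = u / a ^ k"
  have a_inv: "u / a ^ j = u * (1 - s) ^ j" for j by (simp add: a_def power_divide)
  have radius_Suc: "u / a ^ Suc j = u / a ^ j * (1 - s)" for j
    unfolding a_inv by (simp add: mult_ac)
  have radius_pos: "0 < u / a ^ j" for j using a consts_pos by simp
  have radius_less: "u / a ^ j < u / a ^ i" if "i < j" for i j
    using that a consts_pos by (intro divide_strict_left_mono power_strict_increasing) auto
  have \<delta>: "0 < \<delta>" "\<delta> < u" using radius_pos[of k] radius_less[of 0 k] by (simp_all add: \<delta>_def k_def)
  have "\<delta> < u / a ^ n" unfolding \<delta>_def by (rule radius_less) (simp add: k_def)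
  also have "\<dots> < \<delta>\<^sub>0" using n consts_pos by (simp add: a_inv field_simps)
  finally have P_\<delta>: "property_P M f K \<sigma> \<xi> \<gamma> \<rho> \<eta> \<delta>" by (intro P) simp
  define l\<^sub>c where "l\<^sub>c = 1 / (16 * (1 + q))"
  \<comment> \<open>Since \<delta> is the smallest radius, this one intensity is at most a sixteenth
    of the radius at every level.\<close>
  define l where "l = \<delta> / 16"
  define \<alpha> where "\<alpha> j = (1 + q) * (u / a ^ j)" for j
  define J where "J = dwc_interval K u \<delta> a k"
  have J: "J j = {K - u / a ^ j<..<K + u / a ^ j}" for j
    by (simp add: J_def dwc_interval_def \<delta>_def)
  have J_k: "J k = {K - \<delta><..<K + \<delta>}" by (simp add: J_def dwc_interval_def)
  have nested: "J (Suc j) \<subset> J j" for j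
  proof -
    have less: "u / a ^ Suc j < u / a ^ j" by (rule radius_less) simp
    have "K + u / a ^ Suc j \<in> J j - J (Suc j)"
      using less radius_pos[of "Suc j"] radius_pos[of j] unfolding J by auto
    moreover have "J (Suc j) \<subseteq> J j" using less unfolding J by auto
    ultimately show ?thesis by blast
  qed
  have J_0: "J 0 = {K - u<..<K + u}" by (simp add: J)
  have contract: "f v - \<alpha> j * (1 + l\<^sub>c * c) * ((f v - K) / \<bar>f v - K\<bar>) + l * h \<in> J (Suc j)"
    if j: "j < k" and v: "v \<in> J j - J (Suc j)" and c: "\<bar>c\<bar> \<le> 1" and h: "\<bar>h\<bar> \<le> 1" for j v c h
  proof -
    let ?x = "v - K" and ?r = "u / a ^ j"
    have x: "?r * (1 - s) \<le> \<bar>?x\<bar>" "\<bar>?x\<bar> < ?r"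
      using v unfolding J radius_Suc by auto
    have "?r \<le> u" using radius_less[of 0 j] by (cases j) auto
    with x have xu: "\<bar>?x\<bar> < u" by simp
    have f_v: "f v - K = - ((1 + q) * ?x) + \<phi> ?x"
      using f_expansion[of v] xu by (simp add: abs_less_iff)
    have "\<bar>\<phi> ?x\<bar> \<le> C * \<bar>?x\<bar> powr (1 + \<kappa>)" using xu by (intro phi_bound) auto
    also have "\<dots> = C * \<bar>?x\<bar> powr \<kappa> * \<bar>?x\<bar>" by (simp add: powr_add)
    also have "\<dots> \<le> C * u powr \<kappa> * \<bar>?x\<bar>"
      using xu consts_pos by (intro mult_right_mono mult_left_mono powr_mono2) auto
    \<comment> \<open>The assumption \<open>C * u powr \<kappa> < 1 / 2\<close> enters here and
      yields the slopes \<open>1/2 + q\<close> and \<open>3/2 + q\<close>.\<close>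
    also have "\<dots> \<le> 1 / 2 * \<bar>?x\<bar>" using small by (intro mult_right_mono) auto
    finally have \<phi>: "\<bar>\<phi> ?x\<bar> \<le> 1 / 2 * \<bar>?x\<bar>" .
    have "\<bar>(1 + q) * ?x\<bar> = (1 + q) * \<bar>?x\<bar>" using consts_pos by (simp add: abs_mult)
    then have bounds: "(1 + q) * \<bar>?x\<bar> - \<bar>\<phi> ?x\<bar> \<le> \<bar>f v - K\<bar>"
      "\<bar>f v - K\<bar> \<le> (1 + q) * \<bar>?x\<bar> + \<bar>\<phi> ?x\<bar>"
      unfolding f_v by linarith+
    have "(1 / 2 + q) * \<bar>?x\<bar> = (1 + q) * \<bar>?x\<bar> - 1 / 2 * \<bar>?x\<bar>" by (simp add: field_simps)
    also have "\<dots> \<le> (1 + q) * \<bar>?x\<bar> - \<bar>\<phi> ?x\<bar>" using \<phi> by (rule diff_left_mono)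
    also note bounds(1)
    finally have y_lower: "(1 / 2 + q) * \<bar>?x\<bar> \<le> \<bar>f v - K\<bar>" .
    note bounds(2)
    also have "(1 + q) * \<bar>?x\<bar> + \<bar>\<phi> ?x\<bar> \<le> (1 + q) * \<bar>?x\<bar> + 1 / 2 * \<bar>?x\<bar>"
      using \<phi> by (rule add_left_mono)
    also have "\<dots> = (3 / 2 + q) * \<bar>?x\<bar>" by (simp add: field_simps)
    finally have y_upper: "\<bar>f v - K\<bar> \<le> (3 / 2 + q) * \<bar>?x\<bar>" .
    have l: "0 < l" "l \<le> ?r / 16" using \<delta> radius_less[OF j] by (auto simp: l_def \<delta>_def)
    have "\<bar>f v - K - \<alpha> j * (1 + l\<^sub>c * c) * ((f v - K) / \<bar>f v - K\<bar>) + l * h\<bar> < ?r * (1 - s)"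
      unfolding \<alpha>_def l\<^sub>c_def using x
      by (intro dwc_step_contracts[OF consts_pos(2) radius_pos s_def x(1) _ y_lower y_upper c h l]) simp
    then show ?thesis unfolding J radius_Suc by (auto simp: abs_less_iff)
  qed
  have params: "dwc_parameters K u \<delta> a k l l\<^sub>c \<alpha>"
    unfolding dwc_parameters_def J_def[symmetric]
    using a \<delta> consts_pos nested radius_pos by (simp add: k_def l_def l\<^sub>c_def \<alpha>_def)
  have walk: "as_finite_moment M (entry_moment (J k) z) \<and> moment_indep_of_noise M \<xi> (entry_moment (J k) z)
      \<and> (noisy_solution_from M f K \<sigma> \<xi> (entry_moment (J k) z) z \<longrightarrow>
        decay_from_moment M K \<gamma> \<rho> \<eta> (entry_moment (J k) z) z \<and> decay_from_nonrandom M K \<gamma> \<rho> \<eta> z)"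
    if x\<^sub>0: "x\<^sub>0 \<in> J 0" and sol: "dwc_solution M f K u \<delta> a k l l\<^sub>c \<alpha> \<zeta> chi x\<^sub>0 z" for x\<^sub>0 z
  proof -
    have domain: "J 0 \<subseteq> {0..}" unfolding J_0 by (rule interval_in_domain)
    have nested': "J (Suc j) \<subseteq> J j" for j using nested by blast
    have moment: "as_finite_moment M (entry_moment (J k) z)"
      and indep: "moment_indep_of_noise M \<xi> (entry_moment (J k) z)"
      using dwc_entry_moment[of M f K u \<delta> a k, folded J_def, OF M f_cont domain nested' contract
          noises(2,3) noises_indep x\<^sub>0 sol] by auto
    \<comment> \<open>The starting condition of property (P); finiteness of the moment matters since
      \<open>the_enat\<close> is meaningless at \<open>\<infinity>\<close>.\<close>
    have "AE \<omega> in M. z (the_enat (entry_moment (J k) z \<omega>)) \<omega> \<in> J k"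
      using moment unfolding as_finite_moment_def
      by (auto simp: entry_moment_Least split: if_splits intro: LeastI_ex elim!: eventually_mono)
    then show ?thesis
      using P_\<delta> moment indep unfolding property_P_def J_k[symmetric] by blast
  qed
  show ?thesis
  proof (intro exI conjI)
    show "0 < \<rho>" "0 < \<eta>" "0 < \<delta>" "\<delta> < u" by fact+
    show "property_P M f K \<sigma> \<xi> \<gamma> \<rho> \<eta> \<delta>" by fact
    show "dwc_parameters K u \<delta> a k l l\<^sub>c \<alpha>" by fact
  qed (intro ballI allI impI, rule walk[unfolded J_0 J_k], assumption+)
qed

end
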